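(* Let $\boldsymbol\tau=\{\tau_Q : Q\in\mathcal Q\}$ be non-negative constants indexed by the dyadic cubes of $\mathbb R^d$, let $\omega,\sigma$ be weights on $\mathbb R^d$, and let $1<p\le q<\infty$. Define $$ [\![\sigma,\omega]\!]^{\mathrm{Loc}}_{\boldsymbol\tau,p,q} := \sup_{R\in\mathcal Q}\ \omega(R)^{-1/q'}\,\bigl\| T^{\mathrm{in}}_{\boldsymbol\tau,R}(\omega\mathbf 1_R)\bigr\|_{L^{p'}(\sigma)}, \qquad [\![\sigma,\omega]\!]^{\mathrm{Glo}}_{\boldsymbol\tau,p,q} := \sup_{R\in\mathcal Q}\ \omega(R)^{-1/q'}\,\bigl\| T^{\mathrm{out}}_{\boldsymbol\tau,R}(\omega\mathbf 1_R)\bigr\|_{L^{p'}(\sigma)} . $$ Then $$ \bigl\|T_{\boldsymbol\tau}(\sigma\,\cdot)\bigr\|_{L^p(\sigma)\to L^{q,\infty}(\omega)} \simeq [\![\sigma,\omega]\!]^{\mathrm{Loc}}_{\boldsymbol\tau,p,q}\qquad (1<p\le q<\infty), $$ $$ \bigl\|T_{\boldsymbol\tau}(\sigma\,\cdot)\bigr\|_{L^p(\sigma)\to L^{q,\infty}(\omega)} \simeq [\![\sigma,\omega]\!]^{\mathrm{Glo}}_{\boldsymbol\tau,p,q}\qquad (1<p<q<\infty). $$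
   Context: $\mathcal Q$ is a fixed choice of dyadic cubes in $\mathbb R^d$. A weight is a non-negative locally integrable function $\omega:\mathbb R^d\to[0,\infty)$; for a cube $Q$, $\omega(Q)=\int_Q\omega\,dx$, and $L^p(\omega)$ is the $L^p$ space of the measure $\omega\,dx$. For a cube $Q$, $\mathbb E_Q f := |Q|^{-1}\int_Q f\,dx$. For $R\in\mathcal Q$ set $$T_{\boldsymbol\tau}f:=\sum_{Q\in\mathcal Q}\tau_Q\,\mathbb E_Qf\,\mathbf 1_Q,\quad T^{\mathrm{in}}_{\boldsymbol\tau,R}f:=\sum_{Q\in\mathcal Q,\ Q\subset R}\tau_Q\,\mathbb E_Qf\,\mathbf 1_Q,\quad T^{\mathrm{out}}_{\boldsymbol\tau,R}f:=\sum_{Q\in\mathcal Q,\ Q\supset R}\tau_Q\,\mathbb E_Qf\,\mathbf 1_Q$$ (the cube $Q=R$ is included in both localized sums). For $1<r<\infty$, $r'=r/(r-1)$. The quantity $\|T_{\boldsymbol\tau}(\sigma\,\cdot)\|_{L^p(\sigma)\to L^{q,\infty}(\omega)}$ is the least $N\in[0,\infty]$ such that $\sup_{\lambda>0}\lambda\,\omega(\{T_{\boldsymbol\tau}(f\sigma)>\lambda\})^{1/q}\le N\|f\|_{L^p(\sigma)}$ for all non-negative measurable $f$ (since $T_{\boldsymbol\tau}$ is a positive operator this is the same as considering all $f\in L^p(\sigma)$). Cubes $R$ with $\omega(R)=0$ contribute $0$ to the suprema. $A\simeq B$ means $A\le KB$ and $B\le KA$ with a constant $K$ depending only on the dimension $d$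 and on $p,q$ (not on $\boldsymbol\tau,\sigma,\omega$). *)

theory Defs
  imports "HOL-Analysis.Analysis"
begin

section \<open>Dyadic cubes\<close>

definition cube :: "real ^ 'd \<Rightarrow> real \<Rightarrow> (real ^ 'd) set" where
  "cube a l = {x. \<forall>i. a $ i \<le> x $ i \<and> x $ i < a $ i + l}"

text \<open>\<open>gen k\<close> is the generation of cubes of side length \<open>2\<^sup>k\<close>. The grid need not be the
  standard one; in particular, translated grids are allowed.\<close>

definition dyadic_grid :: "(real ^ 'd) set set \<Rightarrow> bool" where
  "dyadic_grid \<Q> \<longleftrightarrow> (\<exists>gen :: int \<Rightarrow> (real ^ 'd) set set.
     \<Q> = (\<Union>k. gen k) \<and>
     (\<forall>k. partition_on UNIV (gen k)) \<and>
     (\<forall>k. \<forall>Q\<in>gen k. \<exists>a. Q = cube a (2 powi k)) \<and>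
     (\<forall>k. \<forall>Q\<in>gen k. \<exists>P\<in>gen (k + 1). Q \<subseteq> P))"

definition standard_dyadic :: "int \<Rightarrow> (real ^ 'd) set set" where
  "standard_dyadic k = range (\<lambda>m :: int ^ 'd. cube (\<chi> i. of_int (m $ i) * 2 powi k) (2 powi k))"

lemma mem_standard_cube:
  fixes m :: "int ^ 'd" and x :: "real ^ 'd"
  shows "x \<in> cube (\<chi> i. of_int (m $ i) * 2 powi k) (2 powi k)
    \<longleftrightarrow> m = (\<chi> i. \<lfloor>x $ i / 2 powi k\<rfloor>)"
proof -
  have pos: "(0::real) < 2 powi k" by simp
  have "(of_int (m $ i) * 2 powi k \<le> x $ i \<and> x $ i < of_int (m $ i) * 2 powi k + 2 powi k)
      \<longleftrightarrow> m $ i = \<lfloor>x $ i / 2 powi k\<rfloor>" for i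
  proof -
    have "of_int (m $ i) * 2 powi k + 2 powi k = (of_int (m $ i) + 1) * (2 powi k :: real)"
      by (simp add: algebra_simps)
    then have "(of_int (m $ i) * 2 powi k \<le> x $ i \<and> x $ i < of_int (m $ i) * 2 powi k + 2 powi k)
      \<longleftrightarrow> of_int (m $ i) \<le> x $ i / 2 powi k \<and> x $ i / 2 powi k < of_int (m $ i) + 1"
      using pos by (simp only: pos_le_divide_eq pos_divide_less_eq)
    also have "\<dots> \<longleftrightarrow> \<lfloor>x $ i / 2 powi k\<rfloor> = m $ i"
      by (simp add: floor_eq_iff)
    finally show ?thesis by auto
  qed
  then show ?thesis
    by (simp add: cube_def vec_eq_iff)
qed

lemma dyadic_grid_standard: "dyadic_grid (\<Union>k. standard_dyadic k :: (real ^ 'd) set set)"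
  unfolding dyadic_grid_def
proof (intro exI[of _ standard_dyadic] conjI allI ballI refl)
  fix k :: int
  show "partition_on UNIV (standard_dyadic k :: (real ^ 'd) set set)"
  proof (rule partition_onI)
    show "\<Union> (standard_dyadic k) = (UNIV :: (real ^ 'd) set)"
      by (auto simp: standard_dyadic_def mem_standard_cube)
  next
    fix P Q :: "(real ^ 'd) set"
    assume "P \<in> standard_dyadic k" "Q \<in> standard_dyadic k" "P \<noteq> Q"
    then show "disjnt P Q"
      by (auto simp: standard_dyadic_def disjnt_iff mem_standard_cube)
  next
    have "(\<chi> i. of_int (m $ i) * 2 powi k) \<in> cube (\<chi> i. of_int (m $ i) * 2 powi k) (2 powi k)"
      for m :: "int ^ 'd"
      by (simp add: cube_def)
    then show "{} \<notin> (standard_dyadic k :: (real ^ 'd) set set)"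
      unfolding standard_dyadic_def by (metis (no_types, lifting) empty_iff imageE)
  qed
next
  fix k :: int and Q :: "(real ^ 'd) set"
  assume "Q \<in> standard_dyadic k"
  then obtain m :: "int ^ 'd"
    where m: "Q = cube (\<chi> i. of_int (m $ i) * 2 powi k) (2 powi k)"
    by (auto simp: standard_dyadic_def)
  then show "\<exists>a. Q = cube a (2 powi k)" by blast
  have eq: "\<lfloor>y / 2 powi (k + 1)\<rfloor> = \<lfloor>y / 2 powi k\<rfloor> div 2" for y :: real
  proof -
    have "\<lfloor>y / 2 powi (k + 1)\<rfloor> = \<lfloor>(y / 2 powi k) / of_int 2\<rfloor>"
      by (simp add: power_int_add)
    also have "\<dots> = \<lfloor>y / 2 powi k\<rfloor> div 2"
      by (rule floor_divide_real_eq_div) simp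
    finally show ?thesis .
  qed
  show "\<exists>P\<in>standard_dyadic (k + 1). Q \<subseteq> P"
  proof
    show "cube (\<chi> i. of_int ((\<chi> i. m $ i div 2) $ i) * 2 powi (k + 1)) (2 powi (k + 1))
        \<in> (standard_dyadic (k + 1) :: (real ^ 'd) set set)"
      unfolding standard_dyadic_def by blast
    show "Q \<subseteq> cube (\<chi> i. of_int ((\<chi> i. m $ i div 2) $ i) * 2 powi (k + 1)) (2 powi (k + 1))"
      unfolding m subset_iff mem_standard_cube by (simp add: eq vec_eq_iff)
  qed
qed


section \<open>Weights and norms\<close>

definition weight :: "(real ^ 'd \<Rightarrow> real) \<Rightarrow> bool" where
  "weight w \<longleftrightarrow> (\<forall>x. 0 \<le> w x) \<and> w \<in> borel_measurable lebesgue \<and>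
     (\<forall>C. compact C \<longrightarrow> w absolutely_integrable_on C)"

definition weighted :: "(real ^ 'd \<Rightarrow> real) \<Rightarrow> (real ^ 'd) measure" where
  "weighted w = density lebesgue (\<lambda>x. ennreal (w x))"

definition conj_exponent :: "real \<Rightarrow> real" where
  "conj_exponent r = r / (r - 1)"

text \<open>Powers on \<open>[0,\<infinity>]\<close>, meant for exponents \<open>a > 0\<close> only.\<close>

definition epowr :: "ennreal \<Rightarrow> real \<Rightarrow> ennreal" where
  "epowr x a = (if x = \<infinity> then \<infinity> else ennreal (enn2real x powr a))"

definition Lp_norm :: "real \<Rightarrow> 'a measure \<Rightarrow> ('a \<Rightarrow> ennreal) \<Rightarrow> ennreal" where
  "Lp_norm p M f = epowr (\<integral>\<^sup>+ x. epowr (f x) p \<partial>M) (1 / p)"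

definition weak_Lp_norm :: "real \<Rightarrow> 'a measure \<Rightarrow> ('a \<Rightarrow> ennreal) \<Rightarrow> ennreal" where
  "weak_Lp_norm q M f =
     (SUP l\<in>{0<..}. ennreal l * epowr (emeasure M {x \<in> space M. ennreal l < f x}) (1 / q))"


section \<open>The dyadic operators\<close>

definition average :: "(real ^ 'd) set \<Rightarrow> (real ^ 'd \<Rightarrow> ennreal) \<Rightarrow> ennreal" where
  "average Q f = (\<integral>\<^sup>+ x\<in>Q. f x \<partial>lebesgue) / emeasure lebesgue Q"

definition dyadic_op ::
    "(real ^ 'd) set set \<Rightarrow> ((real ^ 'd) set \<Rightarrow> real) \<Rightarrow> (real ^ 'd \<Rightarrow> ennreal) \<Rightarrow> real ^ 'd \<Rightarrow> ennreal" where
  "dyadic_op \<S> \<tau> f x = (\<Sum>\<^sub>\<infinity>Q\<in>\<S>. ennreal (\<tau> Q) * average Q f * indicator Q x)"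

definition T_in ::
    "(real ^ 'd) set set \<Rightarrow> ((real ^ 'd) set \<Rightarrow> real) \<Rightarrow> (real ^ 'd) set \<Rightarrow>
     (real ^ 'd \<Rightarrow> ennreal) \<Rightarrow> real ^ 'd \<Rightarrow> ennreal" where
  "T_in \<Q> \<tau> R = dyadic_op {Q \<in> \<Q>. Q \<subseteq> R} \<tau>"

definition T_out ::
    "(real ^ 'd) set set \<Rightarrow> ((real ^ 'd) set \<Rightarrow> real) \<Rightarrow> (real ^ 'd) set \<Rightarrow>
     (real ^ 'd \<Rightarrow> ennreal) \<Rightarrow> real ^ 'd \<Rightarrow> ennreal" where
  "T_out \<Q> \<tau> R = dyadic_op {Q \<in> \<Q>. R \<subseteq> Q} \<tau>"

definition weak_type_norm ::
    "(real ^ 'd) set set \<Rightarrow> ((real ^ 'd) set \<Rightarrow> real) \<Rightarrow> (real ^ 'd \<Rightarrow> real) \<Rightarrow> (real ^ 'd \<Rightarrow> real) \<Rightarrow>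
     real \<Rightarrow> real \<Rightarrow> ennreal" where
  "weak_type_norm \<Q> \<tau> \<sigma> \<omega> p q =
     Inf {N. \<forall>f\<in>borel_measurable lebesgue.
       weak_Lp_norm q (weighted \<omega>) (dyadic_op \<Q> \<tau> (\<lambda>x. f x * ennreal (\<sigma> x)))
         \<le> N * Lp_norm p (weighted \<sigma>) f}"

definition Loc_const ::
    "(real ^ 'd) set set \<Rightarrow> ((real ^ 'd) set \<Rightarrow> real) \<Rightarrow> (real ^ 'd \<Rightarrow> real) \<Rightarrow> (real ^ 'd \<Rightarrow> real) \<Rightarrow>
     real \<Rightarrow> real \<Rightarrow> ennreal" where
  "Loc_const \<Q> \<tau> \<sigma> \<omega> p q =
     (SUP R\<in>\<Q>. if emeasure (weighted \<omega>) R = 0 then 0 else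
        Lp_norm (conj_exponent p) (weighted \<sigma>) (T_in \<Q> \<tau> R (\<lambda>x. ennreal (\<omega> x) * indicator R x))
          / epowr (emeasure (weighted \<omega>) R) (1 / conj_exponent q))"

definition Glo_const ::
    "(real ^ 'd) set set \<Rightarrow> ((real ^ 'd) set \<Rightarrow> real) \<Rightarrow> (real ^ 'd \<Rightarrow> real) \<Rightarrow> (real ^ 'd \<Rightarrow> real) \<Rightarrow>
     real \<Rightarrow> real \<Rightarrow> ennreal" where
  "Glo_const \<Q> \<tau> \<sigma> \<omega> p q =
     (SUP R\<in>\<Q>. if emeasure (weighted \<omega>) R = 0 then 0 else
        Lp_norm (conj_exponent p) (weighted \<sigma>) (T_out \<Q> \<tau> R (\<lambda>x. ennreal (\<omega> x) * indicator R x))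
          / epowr (emeasure (weighted \<omega>) R) (1 / conj_exponent q))"

definition comparable :: "real \<Rightarrow> ennreal \<Rightarrow> ennreal \<Rightarrow> bool" where
  "comparable K A B \<longleftrightarrow> A \<le> ennreal K * B \<and> B \<le> ennreal K * A"

end

theory Submission
  imports Defs
begin

text \<open>Write \<open>\<mu>\<close> and \<open>\<nu>\<close> for the measures with densities \<open>\<sigma>\<close> and \<open>\<omega>\<close>. Then
\<open>T(f \<sigma>)\<close> is the sum of \<open>c\<^sub>Q (\<integral>\<^bsub>Q\<^esub> f d\<mu>) 1\<^sub>Q\<close> with \<open>c\<^sub>Q = \<tau>\<^sub>Q / |Q|\<close>, an operator whose
adjoint is the same sum with \<open>\<mu>\<close> and \<open>\<nu>\<close> exchanged. Of the dyadic cubes only a few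
properties matter: they are measurable and countably many, any two are nested or disjoint, and they have finite
\<open>\<nu>\<close>-measure. The argument is therefore carried out for such a laminar family
(locale \<open>laminar_pair\<close>) and transferred to cubes at the very end.

Necessity of both testing conditions is duality. The \<open>L\<^sup>p\<^sup>'(\<mu>)\<close> norm of the adjoint applied to
\<open>1\<^sub>R\<close> is the supremum of \<open>\<integral>\<^bsub>R\<^esub> T f d\<nu>\<close> over \<open>f\<close> in the unit ball of \<open>L\<^sup>p(\<mu>)\<close>, and Kolmogorov's
inequality bounds the integral of a weak \<open>L\<^sup>q\<close> function over \<open>R\<close> by its weak norm times
\<open>\<nu>(R)\<^sup>1\<^sup>/\<^sup>q\<^sup>'\<close> (\<open>testing_of_weak_type\<close>).

Sufficiency of the local condition is a good-\<open>\<lambda>\<close> argument. By monotone convergence the family may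
be taken finite. The set \<open>{T f > l}\<close> is the union of the maximal sets \<open>Q\<close> in which the terms from
sets containing \<open>Q\<close> add up to more than \<open>l\<close>; by maximality the terms from strictly larger sets add
up to at most \<open>l\<close>, so on \<open>Q \<inter> {T f > 2l}\<close> the part of \<open>T\<close> that lives inside \<open>Q\<close> exceeds \<open>l\<close>
(\<open>maximum_principle\<close>). The testing condition and Hoelder's inequality on \<open>Q\<close> then either make
\<open>\<nu>(Q \<inter> {T f > 2l})\<close> a small fraction of \<open>\<nu>(Q)\<close>, or bound \<open>\<nu>(Q)\<close> by a multiple of
\<open>(\<integral>\<^bsub>Q\<^esub> f\<^sup>p d\<mu>)\<^sup>q\<^sup>/\<^sup>p\<close>; because \<open>p \<le> q\<close> the latter can be summed over the disjoint sets \<open>Q\<close>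
(\<open>good_lambda\<close>). The small fraction is absorbed by iteration.

Sufficiency of the global condition for \<open>p < q\<close> is a pointwise estimate in the spirit of Hedberg.
The sets containing a point \<open>x\<close> form a chain. Testing on the least set \<open>R\<close> of a piece of this chain
with greatest set \<open>P\<close> bounds the contribution of the piece by
\<open>(\<integral>\<^bsub>P\<^esub> f\<^sup>p d\<mu>)\<^sup>1\<^sup>/\<^sup>p \<nu>(R)\<^sup>-\<^sup>1\<^sup>/\<^sup>q\<close> (\<open>chain_sum_le\<close>). One piece is formed by the sets of measure at
least \<open>m\<close>, where the full norm of \<open>f\<close> is used. The smaller sets are cut into layers on which \<open>\<nu>\<close>
is constant up to a factor 2; if \<open>\<integral>\<^bsub>P\<^esub> f\<^sup>p d\<mu> \<le> t \<nu>(P)\<close> for all sets \<open>P\<close> containing \<open>x\<close>, the layers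
contribute a geometric series, convergent because \<open>1/p > 1/q\<close>. With \<open>m\<close> and \<open>t\<close> balanced against
\<open>l\<close> this gives \<open>T f x \<le> l\<close> (\<open>pointwise_bound\<close>), so up to a null set \<open>{T f > l}\<close> is covered by the sets
\<open>P\<close> with \<open>\<integral>\<^bsub>P\<^esub> f\<^sup>p d\<mu> > t \<nu>(P)\<close>, and their union is controlled by the maximal ones among them.\<close>

section \<open>Powers and Lebesgue norms on the extended half-line\<close>

lemma epowr_ennreal [simp]: "0 \<le> r \<Longrightarrow> epowr (ennreal r) a = ennreal (r powr a)"
  by (simp add: epowr_def)

lemma epowr_top [simp]: "epowr top a = top"
  by (simp add: epowr_def)

lemma epowr_0 [simp]: "epowr 0 a = 0"
  by (simp add: epowr_def)

lemma epowr_one [simp]: "epowr x 1 = x"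
  by (cases x) auto

lemma epowr_mono: "x \<le> y \<Longrightarrow> 0 \<le> a \<Longrightarrow> epowr x a \<le> epowr y a"
  by (cases x; cases y) (auto intro!: ennreal_leI powr_mono2 simp: top_unique)

lemma epowr_epowr: "epowr (epowr x a) b = epowr x (a * b)"
  by (cases x) (auto simp: powr_powr)

lemma epowr_mult: "0 < a \<Longrightarrow> epowr (x * y) a = epowr x a * epowr y a"
  by (cases x; cases y)
    (auto simp: ennreal_mult[symmetric] powr_mult ennreal_mult_top ennreal_top_mult)

lemma epowr_eq_top_iff [simp]: "epowr x a = top \<longleftrightarrow> x = top"
  by (cases x) auto

lemma epowr_eq_0_iff [simp]: "epowr x a = 0 \<longleftrightarrow> x = 0"
  by (cases x) auto

lemma epowr_inverse_le_iff: "0 < a \<Longrightarrow> epowr x (1 / a) \<le> y \<longleftrightarrow> x \<le> epowr y a"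
  using epowr_mono[of "epowr x (1 / a)" y a] epowr_mono[of x "epowr y a" "1 / a"]
  by (auto simp: epowr_epowr)

lemma borel_measurable_epowr [measurable]:
  assumes [measurable]: "f \<in> borel_measurable M"
  shows "(\<lambda>x. epowr (f x) a) \<in> borel_measurable M"
  unfolding epowr_def by measurable

lemma Lp_norm_eq_0_imp_AE:
  assumes "f \<in> borel_measurable M" "Lp_norm p M f = 0"
  shows "AE x in M. f x = 0"
  using assms by (auto simp: Lp_norm_def nn_integral_0_iff_AE)

lemma Lp_norm_le_iff:
  "0 < p \<Longrightarrow> Lp_norm p M f \<le> y \<longleftrightarrow> (\<integral>\<^sup>+ x. epowr (f x) p \<partial>M) \<le> epowr y p"
  unfolding Lp_norm_def by (rule epowr_inverse_le_iff)

lemma conj_exponent_gt_1: "1 < p \<Longrightarrow> 1 < conj_exponent p"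
  by (simp add: conj_exponent_def field_simps)

lemma inverse_conj_exponent: "1 < p \<Longrightarrow> 1 / conj_exponent p = 1 - 1 / p"
  by (simp add: conj_exponent_def field_simps)

lemma ennreal_Young:
  assumes "1 < p"
  shows "x * y \<le> epowr x p * ennreal (1 / p)
    + epowr y (conj_exponent p) * ennreal (1 / conj_exponent p)"
proof -
  have q: "1 < conj_exponent p" "1 / p + 1 / conj_exponent p = 1"
    using assms by (simp_all add: conj_exponent_gt_1 inverse_conj_exponent)
  show ?thesis
  proof (cases "x = top \<or> y = top")
    case True
    then show ?thesis using assms q(1) by (auto simp: ennreal_top_mult)
  next
    case False
    then obtain a b where "x = ennreal a" "y = ennreal b" "0 \<le> a" "0 \<le> b"
      by (metis ennreal_cases)
    then show ?thesis
      using Youngs_inequality[OF assms q, of a b] assms q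
      by (auto simp flip: ennreal_mult ennreal_plus intro!: ennreal_leI simp: divide_simps)
  qed
qed

lemma Holder_nn_integral:
  assumes p: "1 < p" and [measurable]: "f \<in> borel_measurable M" "g \<in> borel_measurable M"
  shows "(\<integral>\<^sup>+ x. f x * g x \<partial>M) \<le> Lp_norm p M f * Lp_norm (conj_exponent p) M g"
proof -
  let ?q = "conj_exponent p"
  have q: "1 < ?q" "1 / p + 1 / ?q = 1"
    using p by (simp_all add: conj_exponent_gt_1 inverse_conj_exponent)
  consider "Lp_norm p M f = 0 \<or> Lp_norm ?q M g = 0"
    | "Lp_norm p M f \<noteq> 0" "Lp_norm ?q M g \<noteq> 0" "Lp_norm p M f = top \<or> Lp_norm ?q M g = top"
    | "Lp_norm p M f \<noteq> 0" "Lp_norm ?q M g \<noteq> 0" "Lp_norm p M f \<noteq> top" "Lp_norm ?q M g \<noteq> top"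
    by blast
  then show ?thesis
  proof cases
    case 1
    then have "AE x in M. f x * g x = 0"
      using Lp_norm_eq_0_imp_AE[of f M p] Lp_norm_eq_0_imp_AE[of g M ?q] by auto
    then have "(\<integral>\<^sup>+ x. f x * g x \<partial>M) = 0" by (subst nn_integral_0_iff_AE) auto
    then show ?thesis by simp
  next
    case 2
    then show ?thesis by (auto simp: ennreal_top_mult ennreal_mult_top)
  next
    case 3
    obtain A where A: "Lp_norm p M f = ennreal A" "0 < A"
      using 3 by (cases "Lp_norm p M f") (auto simp: less_le)
    obtain B where B: "Lp_norm ?q M g = ennreal B" "0 < B"
      using 3 by (cases "Lp_norm ?q M g") (auto simp: less_le)
    have IA: "(\<integral>\<^sup>+ x. epowr (f x) p \<partial>M) \<le> ennreal (A powr p)"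
      using A p Lp_norm_le_iff[of p M f "ennreal A"] by simp
    have IB: "(\<integral>\<^sup>+ x. epowr (g x) ?q \<partial>M) \<le> ennreal (B powr ?q)"
      using B q Lp_norm_le_iff[of ?q M g "ennreal B"] by simp
    \<comment> \<open>Young's inequality for \<open>f / A\<close> and \<open>g / B\<close>, which have norm 1\<close>
    have pw: "f x * g x \<le> ennreal (A * B) *
        (ennreal (A powr - p / p) * epowr (f x) p + ennreal (B powr - ?q / ?q) * epowr (g x) ?q)" for x
    proof -
      have eq: "ennreal C * (ennreal (1 / C) * h) = h" if "0 < C" for h C
        using that by (simp add: mult.assoc[symmetric] ennreal_mult[symmetric])
      have "f x * g x = (ennreal A * (ennreal (1 / A) * f x)) * (ennreal B * (ennreal (1 / B) * g x))"
        by (simp only: eq[OF A(2)] eq[OF B(2)])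
      also have "\<dots> = ennreal (A * B) * ((ennreal (1 / A) * f x) * (ennreal (1 / B) * g x))"
        using A(2) B(2) by (simp only: ennreal_mult less_imp_le mult_ac)
      also have "\<dots> \<le> ennreal (A * B) * (epowr (ennreal (1 / A) * f x) p * ennreal (1 / p)
          + epowr (ennreal (1 / B) * g x) ?q * ennreal (1 / ?q))"
        by (intro mult_left_mono ennreal_Young p) simp
      also have "\<dots> = ennreal (A * B) *
        (ennreal (A powr - p / p) * epowr (f x) p + ennreal (B powr - ?q / ?q) * epowr (g x) ?q)"
      proof -
        have e: "epowr (ennreal (1 / C) * h) r * ennreal (1 / r) = ennreal (C powr - r / r) * epowr h r"
          if "0 < C" "0 < r" for C r h
        proof -
          have "C powr - r / r = (1 / C) powr r * (1 / r)"
            using that by (simp add: powr_minus powr_divide field_simps)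
          then have "ennreal (C powr - r / r) = ennreal ((1 / C) powr r) * ennreal (1 / r)"
            using that by (simp only: ennreal_mult powr_ge_zero divide_nonneg_pos zero_le_one)
          then show ?thesis
            using that by (simp add: epowr_mult mult_ac)
        qed
        show ?thesis using A(2) B(2) p q(1) by (simp only: e)
      qed
      finally show ?thesis .
    qed
    have "(\<integral>\<^sup>+ x. f x * g x \<partial>M) \<le> (\<integral>\<^sup>+ x. ennreal (A * B) *
        (ennreal (A powr - p / p) * epowr (f x) p + ennreal (B powr - ?q / ?q) * epowr (g x) ?q) \<partial>M)"
      by (intro nn_integral_mono pw)
    also have "\<dots> = ennreal (A * B) *
        (ennreal (A powr - p / p) * (\<integral>\<^sup>+ x. epowr (f x) p \<partial>M)
          + ennreal (B powr - ?q / ?q) * (\<integral>\<^sup>+ x. epowr (g x) ?q \<partial>M))"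
      by (simp add: nn_integral_cmult nn_integral_add)
    also have "\<dots> \<le> ennreal (A * B) *
        (ennreal (A powr - p / p) * ennreal (A powr p) + ennreal (B powr - ?q / ?q) * ennreal (B powr ?q))"
      by (intro mult_left_mono add_mono IA IB) auto
    also have "\<dots> = ennreal (A * B * (1 / p + 1 / ?q))"
    proof -
      have "A powr - p / p * A powr p = 1 / p" "B powr - ?q / ?q * B powr ?q = 1 / ?q"
        using A(2) B(2) by (simp_all add: powr_minus field_simps)
      then show ?thesis using A(2) B(2) p q(1)
        by (simp flip: ennreal_mult ennreal_plus)
    qed
    also have "\<dots> = Lp_norm p M f * Lp_norm ?q M g"
      using A B q(2) by (simp add: ennreal_mult)
    finally show ?thesis .
  qed
qed

text \<open>The extremal function for the pairing is \<open>g\<^sup>p\<^sup>'\<^sup>-\<^sup>1\<close>. It need not have a finite norm, so \<open>g\<close> is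
truncated in height and to a set of finite measure; for the truncation \<open>h\<close> and \<open>I = \<integral> h\<^sup>p\<^sup>'\<close> the
assumed bound reads \<open>I \<le> C I\<^sup>1\<^sup>/\<^sup>p\<close>, where \<open>I\<close> is finite and can be divided out.\<close>

lemma Lp_norm_le_by_duality:
  assumes p: "1 < p" and sf: "sigma_finite_measure M" and [measurable]: "g \<in> borel_measurable M"
    and bound: "\<And>f. f \<in> borel_measurable M \<Longrightarrow> Lp_norm p M f < top \<Longrightarrow>
      (\<integral>\<^sup>+ x. f x * g x \<partial>M) \<le> C * Lp_norm p M f"
  shows "Lp_norm (conj_exponent p) M g \<le> C"
proof -
  let ?q = "conj_exponent p"
  have q: "1 < ?q" "1 / ?q = 1 - 1 / p" and pq: "(?q - 1) * p = ?q"
    using p by (simp_all add: conj_exponent_gt_1 inverse_conj_exponent)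
      (simp add: conj_exponent_def field_simps)
  obtain A where A: "range A \<subseteq> sets M" "(\<Union>i. A i) = space M" "\<And>i. emeasure M (A i) \<noteq> \<infinity>" "incseq A"
    using sigma_finite_measure.sigma_finite_incseq[OF sf] by metis
  have [measurable]: "A n \<in> sets M" for n using A(1) by auto
  define h where "h n x = min (g x) (of_nat n) * indicator (A n) x" for n x
  have [measurable]: "h n \<in> borel_measurable M" for n unfolding h_def by measurable
  have hle: "h n x \<le> g x" "h n x \<le> of_nat n" for n x
    by (auto simp: h_def indicator_def)
  have inc: "incseq (\<lambda>n x. epowr (h n x) ?q)"
  proof (intro incseq_SucI le_funI epowr_mono)
    fix n x
    show "h n x \<le> h (Suc n) x"
      using A(4) incseq_SucD[OF A(4), of n]
      by (auto simp: h_def indicator_def min.coboundedI2 intro!: min.mono)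
  qed (use q in auto)
  have sup: "(SUP n. epowr (h n x) ?q) = epowr (g x) ?q" if x: "x \<in> space M" for x
  proof (intro antisym SUP_least)
    obtain n0 where n0: "x \<in> A n0" using x unfolding A(2)[symmetric] by blast
    have n0': "x \<in> A n" if "n \<ge> n0" for n using A(4) n0 that by (auto simp: incseq_def)
    show "epowr (g x) ?q \<le> (SUP n. epowr (h n x) ?q)"
    proof (cases "g x")
      case (real r)
      obtain n1 :: nat where "r \<le> of_nat n1" using real_arch_simple by blast
      define n where "n = max n0 n1"
      have "g x \<le> of_nat n"
        using real \<open>r \<le> of_nat n1\<close> unfolding ennreal_of_nat_eq_real_of_nat
        by (auto simp: n_def intro!: ennreal_leI)
      then have "h n x = g x"
        using n0'[of n] by (simp add: h_def n_def)
      then show ?thesis by (metis SUP_upper UNIV_I)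
    next
      case top
      have "(of_nat n :: ennreal) \<le> (SUP n. epowr (h n x) ?q)" for n
      proof -
        have "of_nat n = (ennreal (real n))" by (simp add: ennreal_of_nat_eq_real_of_nat)
        also have "\<dots> \<le> ennreal (real (max n (max n0 1)) powr ?q)"
        proof (intro ennreal_leI)
          have "real n \<le> real (max n (max n0 1)) powr 1" by simp
          also have "\<dots> \<le> real (max n (max n0 1)) powr ?q"
            using q by (intro powr_mono) auto
          finally show "real n \<le> real (max n (max n0 1)) powr ?q" .
        qed
        also have "\<dots> = epowr (h (max n (max n0 1)) x) ?q"
          using top n0'[of "max n (max n0 1)"]
          by (simp add: h_def ennreal_of_nat_eq_real_of_nat)
        also have "\<dots> \<le> (SUP n. epowr (h n x) ?q)" by (intro SUP_upper) auto
        finally show ?thesis .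
      qed
      then have "(SUP n. epowr (h n x) ?q) = top"
        by (metis ennreal_SUP_of_nat_eq_top SUP_least top_unique)
      then show ?thesis by (simp only: top_greatest)
    qed
  qed (use hle q in \<open>auto intro!: epowr_mono\<close>)
  have "(\<integral>\<^sup>+ x. epowr (h n x) ?q \<partial>M) \<le> epowr C ?q" for n
  proof -
    define I where "I = (\<integral>\<^sup>+ x. epowr (h n x) ?q \<partial>M)"
    have "I \<le> (\<integral>\<^sup>+ x. ennreal (real n powr ?q) * indicator (A n) x \<partial>M)"
      unfolding I_def
    proof (intro nn_integral_mono)
      fix x
      show "epowr (h n x) ?q \<le> ennreal (real n powr ?q) * indicator (A n) x"
        using epowr_mono[OF hle(2)[of n x], of ?q] q
        by (cases "x \<in> A n") (auto simp: h_def ennreal_of_nat_eq_real_of_nat)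
    qed
    also have "\<dots> < top"
      using A(3)[of n] by (simp add: nn_integral_cmult_indicator ennreal_mult_less_top less_top)
    finally obtain i where i: "I = ennreal i" "0 \<le> i" by (cases I) auto
    let ?f = "\<lambda>x. epowr (h n x) (?q - 1)"
    have nf: "Lp_norm p M ?f = ennreal (i powr (1 / p))"
      using i unfolding Lp_norm_def by (simp add: epowr_epowr pq I_def)
    have "I \<le> (\<integral>\<^sup>+ x. ?f x * g x \<partial>M)"
      unfolding I_def
    proof (intro nn_integral_mono)
      fix x
      have "epowr (h n x) ?q = ?f x * h n x"
      proof (cases "h n x")
        case (real r)
        have "r powr ?q = r powr (?q - 1) * r"
          using real by (cases "r = 0") (auto simp: powr_diff)
        then show ?thesis using real by (simp add: ennreal_mult)
      qed auto
      also have "\<dots> \<le> ?f x * g x" by (intro mult_left_mono hle) auto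
      finally show "epowr (h n x) ?q \<le> ?f x * g x" .
    qed
    also have "\<dots> \<le> C * Lp_norm p M ?f"
      by (intro bound) (auto simp: nf)
    finally have le: "ennreal i \<le> C * ennreal (i powr (1 / p))" by (simp add: nf i)
    have "I \<le> epowr C ?q"
    proof (cases C)
      case (real c)
      then have "i \<le> c * i powr (1 / p)" using le i by (simp flip: ennreal_mult)
      have "i \<le> c powr ?q"
      proof (cases "i = 0")
        case False
        then have "i / i powr (1 / p) \<le> c"
          using i(2) \<open>i \<le> c * i powr (1 / p)\<close> by (simp add: divide_simps)
        moreover have "i / i powr (1 / p) = i powr (1 / ?q)"
          using False i(2) q by (simp add: powr_diff)
        ultimately have "(i powr (1 / ?q)) powr ?q \<le> c powr ?q"
          using q by (intro powr_mono2) auto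
        then show ?thesis using i q(1) by (simp add: powr_powr)
      qed simp
      then show ?thesis using real i by (simp add: ennreal_leI)
    qed simp
    then show ?thesis by (simp add: I_def)
  qed
  moreover have "(\<integral>\<^sup>+ x. epowr (g x) ?q \<partial>M) = (SUP n. \<integral>\<^sup>+ x. epowr (h n x) ?q \<partial>M)"
    by (subst nn_integral_monotone_convergence_SUP[symmetric])
      (use inc sup in \<open>auto intro!: nn_integral_cong\<close>)
  ultimately show ?thesis
    using q by (simp add: Lp_norm_le_iff SUP_le_iff)
qed

section \<open>Weak norms and Kolmogorov's inequality\<close>

lemma weak_Lp_normD:
  assumes "0 < q" "weak_Lp_norm q M F \<le> ennreal a" "0 \<le> a" "0 < l"
  shows "emeasure M {x \<in> space M. ennreal l < F x} \<le> ennreal ((a / l) powr q)"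
proof -
  let ?E = "emeasure M {x \<in> space M. ennreal l < F x}"
  have "ennreal l * epowr ?E (1 / q) \<le> weak_Lp_norm q M F"
    unfolding weak_Lp_norm_def by (rule SUP_upper) (use \<open>0 < l\<close> in simp)
  also note assms(2)
  finally have "ennreal (1 / l) * (ennreal l * epowr ?E (1 / q)) \<le> ennreal (1 / l) * ennreal a"
    by (rule mult_left_mono) simp
  then have "epowr ?E (1 / q) \<le> ennreal (a / l)"
    using assms by (simp add: mult.assoc[symmetric] ennreal_mult[symmetric])
  then show ?thesis
    using assms by (simp add: epowr_inverse_le_iff)
qed

lemma weak_Lp_normI:
  assumes "0 < q" "0 \<le> a"
    and bound: "\<And>l. 0 < l \<Longrightarrow> emeasure M {x \<in> space M. ennreal l < F x} \<le> ennreal ((a / l) powr q)"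
  shows "weak_Lp_norm q M F \<le> ennreal a"
  unfolding weak_Lp_norm_def
proof (rule SUP_least)
  fix l :: real assume "l \<in> {0<..}"
  then have l: "0 < l" by simp
  let ?E = "emeasure M {x \<in> space M. ennreal l < F x}"
  have "epowr ?E (1 / q) \<le> ennreal (a / l)"
    using bound[OF l] assms l by (simp add: epowr_inverse_le_iff)
  then have "ennreal l * epowr ?E (1 / q) \<le> ennreal l * ennreal (a / l)"
    by (rule mult_left_mono) simp
  also have "\<dots> = ennreal a" using assms l by (simp add: ennreal_mult[symmetric])
  finally show "ennreal l * epowr ?E (1 / q) \<le> ennreal a" .
qed

text \<open>The estimates are homogeneous, but their proofs divide by norms and constants. This lemma allows
such a quantity \<open>x\<close> to be replaced by a positive real upper bound, which covers the case \<open>x = 0\<close>.\<close>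

lemma ennreal_le_mult_approx:
  fixes x y z :: ennreal
  assumes "x < top" "z < top" and le: "\<And>a. 0 < a \<Longrightarrow> x \<le> ennreal a \<Longrightarrow> y \<le> ennreal a * z"
  shows "y \<le> x * z"
proof -
  obtain r where r: "x = ennreal r" "0 \<le> r" using \<open>x < top\<close> by (cases x) auto
  obtain s where s: "z = ennreal s" "0 \<le> s" using \<open>z < top\<close> by (cases z) auto
  have "y \<le> ennreal (r * s) + ennreal e" if "0 < e" for e
  proof -
    let ?a = "r + e / (s + 1)"
    have "y \<le> ennreal ?a * z"
      using r s that by (intro le) (auto intro!: ennreal_leI add_nonneg_pos)
    also have "\<dots> = ennreal (?a * s)" using r s that by (simp add: ennreal_mult)
    also have "\<dots> \<le> ennreal (r * s + e)"
      using r s that by (intro ennreal_leI) (simp add: field_simps)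
    finally show ?thesis using r s that by simp
  qed
  then have "y \<le> ennreal (r * s)" by (rule ennreal_le_epsilon)
  then show ?thesis using r s by (simp add: ennreal_mult)
qed

lemma le_suminf_ennreal: "(f :: nat \<Rightarrow> ennreal) k \<le> (\<Sum>i. f i)"
  using sum_le_suminf[of f "{k}"] by simp

lemma le_dyadic_layers:
  fixes y :: ennreal
  assumes s: "0 < s"
  shows "y \<le> ennreal s + (\<Sum>k. ennreal (2 ^ Suc k * s) * of_bool (ennreal (2 ^ k * s) < y))"
    (is "_ \<le> _ + (\<Sum>k. ?t k)")
proof (cases y)
  case (real r)
  show ?thesis
  proof (cases "r \<le> s")
    case True
    then have "y \<le> ennreal s" using real by (simp add: ennreal_leI)
    then show ?thesis by (rule order_trans) simp
  next
    case False
    obtain n where "r / s < 2 ^ n" using real_arch_pow[of 2 "r / s"] by auto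
    then have n: "r \<le> 2 ^ n * s" using s by (simp add: field_simps)
    define k where "k = (LEAST k. r \<le> 2 ^ k * s)"
    have k: "r \<le> 2 ^ k * s" unfolding k_def by (rule LeastI) (rule n)
    obtain j where j: "k = Suc j" using k False by (cases k) auto
    have "\<not> r \<le> 2 ^ j * s" using not_less_Least[of j "\<lambda>k. r \<le> 2 ^ k * s"] j k_def by simp
    then have "?t j = ennreal (2 ^ Suc j * s)"
      using real s by (simp add: ennreal_less_iff)
    then have "y \<le> ?t j" using real k j by (simp add: ennreal_leI)
    also have "\<dots> \<le> (\<Sum>k. ?t k)" by (rule le_suminf_ennreal)
    finally show ?thesis by (rule order_trans) simp
  qed
next
  case top
  have "(\<Sum>k. ?t k) = top"
  proof (rule ccontr)
    assume "(\<Sum>k. ?t k) \<noteq> top"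
    then obtain b where b: "(\<Sum>k. ?t k) = ennreal b" "0 \<le> b" by (cases "\<Sum>k. ?t k") auto
    obtain n where n: "b / s < 2 ^ n" using real_arch_pow[of 2 "b / s"] by auto
    have "?t n \<le> ennreal b" using le_suminf_ennreal[of ?t n] b by simp
    then have "2 ^ Suc n * s \<le> b" using top s b by simp
    moreover have "b < 2 ^ n * s" using n s by (simp add: field_simps)
    moreover have "0 < 2 ^ n * s" using s by simp
    ultimately show False by (simp add: mult.assoc)
  qed
  then show ?thesis by simp
qed

text \<open>The trivial contribution 1 of the range below the critical height plus the sum of the geometric
series \<open>2 \<Sum>\<^sub>k 2\<^sup>k\<^sup>(\<^sup>1\<^sup>-\<^sup>q\<^sup>)\<close> over the layers above it.\<close>

definition kolmogorov_const :: "real \<Rightarrow> real" where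
  "kolmogorov_const q = 1 + 2 / (1 - 2 powr (1 - q))"

lemma kolmogorov_const_pos: "1 < q \<Longrightarrow> 0 < kolmogorov_const q"
proof -
  assume "1 < q"
  then have "2 powr (1 - q) < 2 powr (0::real)" by (intro powr_less_mono) auto
  then show ?thesis by (simp add: kolmogorov_const_def add_pos_pos)
qed

text \<open>Summing over the dyadic layers \<open>{2\<^sup>k s < F}\<close>, the weak bound gives a geometric series with ratio
\<open>2\<^sup>1\<^sup>-\<^sup>q\<close>.\<close>

lemma Kolmogorov_inequality:
  assumes q: "1 < q" and [measurable]: "F \<in> borel_measurable M" "R \<in> sets M"
    and fin: "emeasure M R < top"
  shows "(\<integral>\<^sup>+ x\<in>R. F x \<partial>M)
    \<le> weak_Lp_norm q M F * (ennreal (kolmogorov_const q) * epowr (emeasure M R) (1 / conj_exponent q))"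
proof (cases "emeasure M R = 0")
  case True
  then have "(\<integral>\<^sup>+ x\<in>R. F x \<partial>M) = 0"
    by (intro nn_integral_null_set) (auto simp: null_sets_def)
  then show ?thesis by simp
next
  case False
  obtain m where m: "emeasure M R = ennreal m" "0 < m"
    using fin False by (cases "emeasure M R") (auto simp: less_le)
  let ?K = "kolmogorov_const q" and ?u = "m powr (1 - 1 / q)"
  define r where "r = 2 powr (1 - q)"
  have r: "0 < r" "r < 1"
    using q powr_less_mono[of "1 - q" 0 2] by (auto simp: r_def)
  show ?thesis
  proof (cases "weak_Lp_norm q M F = top")
    case True
    then show ?thesis
      using m kolmogorov_const_pos[OF q] by (simp add: ennreal_top_mult)
  next
    case fin: False
    show ?thesis
    proof (rule ennreal_le_mult_approx)
      fix a :: real assume a: "0 < a" "weak_Lp_norm q M F \<le> ennreal a"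
      \<comment> \<open>the height at which the weak-type bound \<open>(a/s)\<^sup>q\<close> equals the measure of \<open>R\<close>\<close>
      define s where "s = a / m powr (1 / q)"
      have s: "0 < s" using a m by (simp add: s_def)
      let ?A = "\<lambda>k. {x \<in> space M. ennreal (2 ^ k * s) < F x}"
      have layer: "ennreal (2 ^ Suc k * s) * emeasure M (?A k) \<le> ennreal (2 * s * m * r ^ k)" for k
      proof -
        have "emeasure M (?A k) \<le> ennreal ((a / (2 ^ k * s)) powr q)"
          using a s q by (intro weak_Lp_normD) auto
        also have "(a / (2 ^ k * s)) powr q = m / (2 ^ k) powr q"
          using a m q by (simp add: s_def powr_divide powr_mult powr_powr)
        finally have "ennreal (2 ^ Suc k * s) * emeasure M (?A k)
            \<le> ennreal (2 ^ Suc k * s) * ennreal (m / (2 ^ k) powr q)"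
          by (rule mult_left_mono) simp
        also have "\<dots> = ennreal (2 ^ Suc k * s * (m / (2 ^ k) powr q))"
          by (rule ennreal_mult[symmetric]) (use s m in auto)
        also have "2 ^ Suc k * s * (m / (2 ^ k) powr q) = 2 * s * m * r ^ k"
        proof -
          have "r ^ k = 2 ^ k / (2 ^ k) powr q"
            unfolding r_def
            by (simp add: powr_realpow[symmetric] powr_powr powr_power powr_diff[symmetric] algebra_simps)
          then show ?thesis by simp
        qed
        finally show ?thesis .
      qed
      have "(\<integral>\<^sup>+ x\<in>R. F x \<partial>M) \<le> (\<integral>\<^sup>+ x. ennreal s * indicator R x
          + (\<Sum>k. ennreal (2 ^ Suc k * s) * indicator (?A k) x) \<partial>M)"
      proof (rule nn_integral_mono)
        fix x assume "x \<in> space M"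
        then show "F x * indicator R x \<le> ennreal s * indicator R x
          + (\<Sum>k. ennreal (2 ^ Suc k * s) * indicator (?A k) x)"
          using le_dyadic_layers[OF s, of "F x"]
          by (cases "x \<in> R") (auto simp: indicator_def of_bool_def)
      qed
      also have "\<dots> = ennreal s * emeasure M R
          + (\<Sum>k. ennreal (2 ^ Suc k * s) * emeasure M (?A k))"
        by (simp add: nn_integral_add nn_integral_suminf nn_integral_cmult_indicator)
      also have "\<dots> \<le> ennreal s * ennreal m + (\<Sum>k. ennreal (2 * s * m * r ^ k))"
        by (intro add_mono suminf_le layer) (auto simp: m)
      also have "(\<Sum>k. ennreal (2 * s * m * r ^ k)) = ennreal (2 * s * m / (1 - r))"
      proof -
        have "(\<lambda>k. 2 * s * m * r ^ k) sums (2 * s * m * (1 / (1 - r)))"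
          using r by (intro sums_mult geometric_sums) auto
        then show ?thesis
          using r s m by (intro suminf_ennreal_eq) auto
      qed
      also have "ennreal s * ennreal m + ennreal (2 * s * m / (1 - r)) = ennreal (s * m * ?K)"
        using r s m by (simp add: kolmogorov_const_def r_def[symmetric] algebra_simps
          flip: ennreal_mult ennreal_plus)
      also have "s * m * ?K = a * (?K * ?u)"
        using m by (simp add: s_def powr_diff)
      also have "ennreal (a * (?K * ?u)) = ennreal a * (ennreal ?K * ennreal ?u)"
        using a kolmogorov_const_pos[OF q] by (simp add: ennreal_mult)
      finally show "(\<integral>\<^sup>+ x\<in>R. F x \<partial>M)
        \<le> ennreal a * (ennreal ?K * epowr (emeasure M R) (1 / conj_exponent q))"
        using m q by (simp add: inverse_conj_exponent)
    qed (use fin m in \<open>simp_all add: top.not_eq_extremum[symmetric] ennreal_mult_eq_top_iff\<close>)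
  qed
qed

section \<open>Positive operators over countable families of sets\<close>

definition positive_op ::
    "('a set \<Rightarrow> ennreal) \<Rightarrow> 'a set set \<Rightarrow> 'a measure \<Rightarrow> ('a \<Rightarrow> ennreal) \<Rightarrow> 'a \<Rightarrow> ennreal" where
  "positive_op c S M f x = (\<Sum>\<^sub>\<infinity>Q\<in>S. c Q * (\<integral>\<^sup>+ y\<in>Q. f y \<partial>M) * indicator Q x)"

lemma infsum_ennreal_eq_SUP:
  "infsum (f :: _ \<Rightarrow> ennreal) A = (SUP F\<in>{F. finite F \<and> F \<subseteq> A}. sum f F)"
  by (rule nonneg_infsum_complete) simp

lemma infsum_ennreal_eq_nn_integral:
  fixes f :: "'a \<Rightarrow> ennreal"
  assumes "countable A"
  shows "infsum f A = (\<integral>\<^sup>+ x. f x \<partial>count_space A)"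
proof (cases "finite A")
  case True
  then show ?thesis by (simp add: nn_integral_count_space_finite)
next
  case False
  let ?g = "from_nat_into A"
  have bij: "bij_betw ?g UNIV A" using assms False by (rule bij_betw_from_nat_into)
  show ?thesis
  proof (rule antisym)
    show "infsum f A \<le> (\<integral>\<^sup>+ x. f x \<partial>count_space A)"
      unfolding infsum_ennreal_eq_SUP
    proof (rule SUP_least, clarify)
      fix F assume F: "finite F" "F \<subseteq> A"
      have "sum f F = (\<integral>\<^sup>+ x. f x * indicator F x \<partial>count_space A)"
        using F by (subst nn_integral_count_space'[of F]) (auto intro!: sum.cong)
      also have "\<dots> \<le> (\<integral>\<^sup>+ x. f x \<partial>count_space A)"
        by (intro nn_integral_mono) (auto simp: indicator_def)
      finally show "sum f F \<le> (\<integral>\<^sup>+ x. f x \<partial>count_space A)" .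
    qed
    have "(\<integral>\<^sup>+ x. f x \<partial>count_space A) = (\<Sum>n. f (?g n))"
      by (simp add: nn_integral_bij_count_space[OF bij, symmetric] nn_integral_count_space_nat)
    also have "\<dots> = (SUP n. \<Sum>i<n. f (?g i))"
      by (rule suminf_eq_SUP)
    also have "\<dots> \<le> infsum f A"
      unfolding infsum_ennreal_eq_SUP
    proof (rule SUP_least)
      fix n
      have "(\<Sum>i<n. f (?g i)) = sum f (?g ` {..<n})"
        using bij by (subst sum.reindex) (auto simp: bij_betw_def intro: inj_on_subset)
      then show "(\<Sum>i<n. f (?g i)) \<le> (SUP F\<in>{F. finite F \<and> F \<subseteq> A}. sum f F)"
        using bij by (auto simp: bij_betw_def intro!: SUP_upper)
    qed
    finally show "(\<integral>\<^sup>+ x. f x \<partial>count_space A) \<le> infsum f A" .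
  qed
qed

lemma positive_op_finite:
  "finite F \<Longrightarrow> positive_op c F M f x = (\<Sum>Q\<in>F. c Q * (\<integral>\<^sup>+ y\<in>Q. f y \<partial>M) * indicator Q x)"
  by (simp add: positive_op_def)

lemma positive_op_mono_family:
  "S \<subseteq> S' \<Longrightarrow> positive_op c S M f x \<le> positive_op c S' M f x"
  unfolding positive_op_def infsum_ennreal_eq_SUP by (rule SUP_subset_mono) auto

lemma borel_measurable_positive_op:
  assumes "countable S" and sets: "S \<subseteq> sets N"
  shows "positive_op c S M f \<in> borel_measurable N"
proof -
  have "(\<lambda>x. SUP F\<in>{F. finite F \<and> F \<subseteq> S}. \<Sum>Q\<in>F. c Q * (\<integral>\<^sup>+ y\<in>Q. f y \<partial>M) * indicator Q x)
      \<in> borel_measurable N"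
  proof (rule borel_measurable_SUP)
    show "countable {F. finite F \<and> F \<subseteq> S}"
      by (rule countable_Collect_finite_subset) fact
    show "(\<lambda>x. \<Sum>Q\<in>F. c Q * (\<integral>\<^sup>+ y\<in>Q. f y \<partial>M) * indicator Q x) \<in> borel_measurable N"
      if "F \<in> {F. finite F \<and> F \<subseteq> S}" for F
      using that sets by (intro borel_measurable_sum borel_measurable_times borel_measurable_indicator) auto
  qed
  then show ?thesis
    by (simp add: positive_op_def[abs_def] infsum_ennreal_eq_SUP)
qed

lemma nn_integral_mult_positive_op:
  assumes S: "countable S" "S \<subseteq> sets N" and [measurable]: "g \<in> borel_measurable N"
  shows "(\<integral>\<^sup>+ x. g x * positive_op c S M f x \<partial>N)
    = (\<integral>\<^sup>+ Q. c Q * (\<integral>\<^sup>+ y\<in>Q. f y \<partial>M) * (\<integral>\<^sup>+ y\<in>Q. g y \<partial>N) \<partial>count_space S)"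
proof -
  let ?h = "\<lambda>Q. c Q * (\<integral>\<^sup>+ y\<in>Q. f y \<partial>M)"
  have [measurable]: "Q \<in> sets N" if "Q \<in> S" for Q using that S by auto
  have "(\<integral>\<^sup>+ x. g x * positive_op c S M f x \<partial>N)
      = (\<integral>\<^sup>+ x. (\<integral>\<^sup>+ Q. ?h Q * (g x * indicator Q x) \<partial>count_space S) \<partial>N)"
    by (simp add: positive_op_def infsum_ennreal_eq_nn_integral[OF S(1)] nn_integral_cmult[symmetric]
      mult_ac)
  also have "\<dots> = (\<integral>\<^sup>+ Q. (\<integral>\<^sup>+ x. ?h Q * (g x * indicator Q x) \<partial>N) \<partial>count_space S)"
    by (rule nn_integral_count_space_nn_integral) (use S in auto)
  also have "\<dots> = (\<integral>\<^sup>+ Q. ?h Q * (\<integral>\<^sup>+ y\<in>Q. g y \<partial>N) \<partial>count_space S)"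
    by (intro nn_integral_cong nn_integral_cmult) (use S in auto)
  finally show ?thesis .
qed

lemma positive_op_adjoint:
  assumes "countable S" "S \<subseteq> sets M" "sets N = sets M"
    and "f \<in> borel_measurable M" "g \<in> borel_measurable N"
  shows "(\<integral>\<^sup>+ x. f x * positive_op c S N g x \<partial>M) = (\<integral>\<^sup>+ x. g x * positive_op c S M f x \<partial>N)"
  using assms by (simp add: nn_integral_mult_positive_op mult_ac)

text \<open>The superlevel sets of the full operator are increasing unions of those of finite partial sums, so
every distributional bound that is uniform in finite families passes to the whole family.\<close>

lemma emeasure_positive_op_le_of_finite:
  assumes S: "countable S" "S \<subseteq> sets N"
    and bound: "\<And>F. finite F \<Longrightarrow> F \<subseteq> S \<Longrightarrow>
      emeasure N {x \<in> space N. l < positive_op c F M f x} \<le> B"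
  shows "emeasure N {x \<in> space N. l < positive_op c S M f x} \<le> B"
proof (cases "S = {}")
  case True
  then show ?thesis using bound[of "{}"] by simp
next
  case False
  define F where "F n = from_nat_into S ` {..<n}" for n
  have F: "finite (F n)" "F n \<subseteq> S" for n
    using from_nat_into[OF False] by (auto simp: F_def)
  let ?E = "\<lambda>n. {x \<in> space N. l < positive_op c (F n) M f x}"
  have Fmeas: "positive_op c (F n) M f \<in> borel_measurable N" for n
    using F[of n] S by (intro borel_measurable_positive_op) (auto intro: countable_finite)
  have meas: "range ?E \<subseteq> sets N" using Fmeas by auto
  have inc: "incseq ?E"
  proof (rule incseq_SucI)
    fix n
    have "F n \<subseteq> F (Suc n)" by (auto simp: F_def)
    then show "?E n \<subseteq> ?E (Suc n)"
      using positive_op_mono_family[of "F n" "F (Suc n)" c M f] by (auto intro: less_le_trans)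
  qed
  have "{x \<in> space N. l < positive_op c S M f x} \<subseteq> (\<Union>n. ?E n)"
  proof clarify
    fix x assume x: "x \<in> space N" "l < positive_op c S M f x"
    then obtain G where G: "finite G" "G \<subseteq> S" "l < positive_op c G M f x"
      by (auto simp: positive_op_def infsum_ennreal_eq_SUP less_SUP_iff)
    have "\<exists>n. G \<subseteq> F n"
      using G(1,2)
    proof (induction G)
      case (insert Q G)
      then obtain n where n: "G \<subseteq> F n" by auto
      obtain i where "from_nat_into S i = Q"
        using from_nat_into_surj[OF S(1), of Q] insert by auto
      then have "insert Q G \<subseteq> F (max n (Suc i))"
        using n by (fastforce simp: F_def)
      then show ?case ..
    qed auto
    then obtain n where "G \<subseteq> F n" ..
    then have "l < positive_op c (F n) M f x"
      using G(3) positive_op_mono_family[of G "F n" c M f x] by (auto intro: less_le_trans)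
    then show "x \<in> (\<Union>n. ?E n)" using x by auto
  qed
  then have "emeasure N {x \<in> space N. l < positive_op c S M f x} \<le> emeasure N (\<Union>n. ?E n)"
    using meas by (intro emeasure_mono) auto
  also have "\<dots> = (SUP n. emeasure N (?E n))"
    using meas inc by (rule SUP_emeasure_incseq[symmetric])
  also have "\<dots> \<le> B"
    by (intro SUP_least bound F)
  finally show ?thesis .
qed

section \<open>Laminar families\<close>

definition maximal_sets :: "'a set set \<Rightarrow> 'a set set" where
  "maximal_sets B = {Q \<in> B. \<forall>P\<in>B. Q \<subseteq> P \<longrightarrow> P = Q}"

lemma maximal_sets_subset: "maximal_sets B \<subseteq> B"
  by (auto simp: maximal_sets_def)

lemma finite_maximal_sets: "finite B \<Longrightarrow> finite (maximal_sets B)"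
  by (rule finite_subset[OF maximal_sets_subset])

lemma Union_maximal_sets:
  assumes "finite B"
  shows "\<Union>(maximal_sets B) = \<Union>B"
proof (rule antisym)
  show "\<Union>B \<subseteq> \<Union>(maximal_sets B)"
  proof (rule Union_least)
    fix Q assume "Q \<in> B"
    from finite_has_maximal2[OF assms this] obtain m
      where "m \<in> B" "Q \<subseteq> m" "\<forall>b\<in>B. m \<subseteq> b \<longrightarrow> m = b" by auto
    then show "Q \<subseteq> \<Union>(maximal_sets B)"
      by (auto simp: maximal_sets_def)
  qed
qed (use maximal_sets_subset in blast)

locale laminar_pair =
  fixes \<mu> \<nu> :: "'a measure" and \<Q> :: "'a set set" and c :: "'a set \<Rightarrow> ennreal"
  assumes sets_eq: "sets \<nu> = sets \<mu>"
    and sigma_finite: "sigma_finite_measure \<mu>"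
    and countable_family: "countable \<Q>"
    and family_sets: "\<Q> \<subseteq> sets \<mu>"
    and laminar: "P \<in> \<Q> \<Longrightarrow> Q \<in> \<Q> \<Longrightarrow> P \<subseteq> Q \<or> Q \<subseteq> P \<or> P \<inter> Q = {}"
    and finite_measure: "Q \<in> \<Q> \<Longrightarrow> emeasure \<nu> Q < top"
begin

abbreviation T :: "'a set set \<Rightarrow> ('a \<Rightarrow> ennreal) \<Rightarrow> 'a \<Rightarrow> ennreal" where
  "T S \<equiv> positive_op c S \<mu>"

abbreviation T_adj :: "'a set set \<Rightarrow> ('a \<Rightarrow> ennreal) \<Rightarrow> 'a \<Rightarrow> ennreal" where
  "T_adj S \<equiv> positive_op c S \<nu>"

lemma family_sets' [measurable]: "Q \<in> \<Q> \<Longrightarrow> Q \<in> sets \<mu>" "Q \<in> \<Q> \<Longrightarrow> Q \<in> sets \<nu>"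
  using family_sets sets_eq by auto

lemma measurable_T [measurable]:
  assumes "S \<subseteq> \<Q>"
  shows "positive_op c S M f \<in> borel_measurable \<mu>" "positive_op c S M f \<in> borel_measurable \<nu>"
proof -
  have "countable S" "S \<subseteq> sets \<mu>" "S \<subseteq> sets \<nu>"
    using assms countable_family family_sets sets_eq by (auto intro: countable_subset)
  then show "positive_op c S M f \<in> borel_measurable \<mu>" "positive_op c S M f \<in> borel_measurable \<nu>"
    by (auto intro: borel_measurable_positive_op)
qed

lemma adjoint:
  assumes "S \<subseteq> \<Q>" "f \<in> borel_measurable \<mu>" "g \<in> borel_measurable \<nu>"
  shows "(\<integral>\<^sup>+ x. f x * T_adj S g x \<partial>\<mu>) = (\<integral>\<^sup>+ x. g x * T S f x \<partial>\<nu>)"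
  using assms countable_subset[OF _ countable_family] family_sets sets_eq
  by (intro positive_op_adjoint) auto

lemma disjoint_maximal_sets:
  assumes "B \<subseteq> \<Q>" "P \<in> maximal_sets B" "Q \<in> maximal_sets B" "P \<noteq> Q"
  shows "P \<inter> Q = {}"
  using assms laminar[of P Q] unfolding maximal_sets_def by blast

lemma sum_over_maximal_sets:
  assumes B: "finite B" "B \<subseteq> \<Q>" and M: "sets M = sets \<mu>"
  shows "(\<Sum>Q\<in>maximal_sets B. emeasure M Q) = emeasure M (\<Union>B)"
proof -
  have "(\<Sum>Q\<in>maximal_sets B. emeasure M Q) = emeasure M (\<Union>Q\<in>maximal_sets B. Q)"
    using B M maximal_sets_subset[of B] family_sets disjoint_maximal_sets[OF B(2)]
    by (intro sum_emeasure finite_maximal_sets) (auto simp: disjoint_family_on_def)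
  then show ?thesis using Union_maximal_sets[OF B(1)] by simp
qed

lemma sum_nn_integral_maximal_sets_le:
  assumes B: "finite B" "B \<subseteq> \<Q>" and [measurable]: "g \<in> borel_measurable \<mu>"
  shows "(\<Sum>Q\<in>maximal_sets B. \<integral>\<^sup>+ x\<in>Q. g x \<partial>\<mu>) \<le> (\<integral>\<^sup>+ x. g x \<partial>\<mu>)"
proof -
  have "(\<Sum>Q\<in>maximal_sets B. \<integral>\<^sup>+ x\<in>Q. g x \<partial>\<mu>)
      = (\<Sum>Q\<in>maximal_sets B. emeasure (density \<mu> g) Q)"
    using B maximal_sets_subset[of B] by (intro sum.cong) (auto simp: emeasure_density)
  also have "\<dots> = emeasure (density \<mu> g) (\<Union>B)"
    using B by (intro sum_over_maximal_sets) auto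
  also have "\<dots> \<le> emeasure (density \<mu> g) (space \<mu>)"
    using emeasure_space[of "density \<mu> g"] by simp
  also have "\<dots> = (\<integral>\<^sup>+ x. g x \<partial>\<mu>)"
    by (simp add: emeasure_density cong: nn_integral_cong)
  finally show ?thesis .
qed

lemma obtain_least:
  assumes "finite S" "S \<subseteq> \<Q>" "S \<noteq> {}" "A \<noteq> {}" "\<And>Q. Q \<in> S \<Longrightarrow> A \<subseteq> Q"
  obtains R where "R \<in> S" "\<And>Q. Q \<in> S \<Longrightarrow> R \<subseteq> Q"
proof -
  obtain R where R: "R \<in> S" "\<And>Q. Q \<in> S \<Longrightarrow> Q \<subseteq> R \<Longrightarrow> R = Q"
    using finite_has_minimal[OF assms(1,3)] by metis
  have "R \<subseteq> Q" if "Q \<in> S" for Q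
    using laminar[of R Q] assms R that by blast
  then show thesis using R that by blast
qed

lemma obtain_greatest:
  assumes "finite S" "S \<subseteq> \<Q>" "S \<noteq> {}" "\<And>Q. Q \<in> S \<Longrightarrow> x \<in> Q"
  obtains P where "P \<in> S" "\<And>Q. Q \<in> S \<Longrightarrow> Q \<subseteq> P"
proof -
  obtain R where R: "R \<in> S" "\<And>Q. Q \<in> S \<Longrightarrow> R \<subseteq> Q \<Longrightarrow> R = Q"
    using finite_has_maximal[OF assms(1,3)] by metis
  have "Q \<subseteq> R" if "Q \<in> S" for Q
    using laminar[of R Q] assms R that by blast
  then show thesis using R that by blast
qed

section \<open>Testing conditions from weak-type bounds\<close>

text \<open>The operator \<open>T S\<close> is dominated by \<open>T \<Q>\<close>, so one argument serves the local and the global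
subfamilies.\<close>

lemma testing_of_weak_type:
  assumes p: "1 < p" and q: "1 < q" and S: "S \<subseteq> \<Q>" and R: "R \<in> \<Q>"
    and weak: "\<And>f. f \<in> borel_measurable \<mu> \<Longrightarrow>
      weak_Lp_norm q \<nu> (T \<Q> f) \<le> N * Lp_norm p \<mu> f"
  shows "Lp_norm (conj_exponent p) \<mu> (T_adj S (indicator R))
    \<le> ennreal (kolmogorov_const q) * N * epowr (emeasure \<nu> R) (1 / conj_exponent q)"
proof (rule Lp_norm_le_by_duality[OF p sigma_finite])
  let ?u = "ennreal (kolmogorov_const q) * epowr (emeasure \<nu> R) (1 / conj_exponent q)"
  show "T_adj S (indicator R) \<in> borel_measurable \<mu>" using S by measurable
  fix f :: "'a \<Rightarrow> ennreal" assume f [measurable]: "f \<in> borel_measurable \<mu>"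
  have "(\<integral>\<^sup>+ x. f x * T_adj S (indicator R) x \<partial>\<mu>) = (\<integral>\<^sup>+ x. indicator R x * T S f x \<partial>\<nu>)"
    using R by (intro adjoint S) auto
  also have "\<dots> \<le> (\<integral>\<^sup>+ x\<in>R. T \<Q> f x \<partial>\<nu>)"
    using S by (intro nn_integral_mono) (auto simp: indicator_def positive_op_mono_family)
  also have "\<dots> \<le> weak_Lp_norm q \<nu> (T \<Q> f) * ?u"
    using R finite_measure by (intro Kolmogorov_inequality q) auto
  also have "\<dots> \<le> (N * Lp_norm p \<mu> f) * ?u"
    by (intro mult_right_mono weak f) simp
  finally show "(\<integral>\<^sup>+ x. f x * T_adj S (indicator R) x \<partial>\<mu>)
    \<le> ennreal (kolmogorov_const q) * N * epowr (emeasure \<nu> R) (1 / conj_exponent q) * Lp_norm p \<mu> f"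
    by (simp add: mult_ac)
qed

text \<open>Only the values of \<open>f\<close> on \<open>A\<close> enter \<open>T S f\<close>, so Hoelder's inequality costs the norm of \<open>f\<close> on
\<open>A\<close> alone. For the local condition \<open>A = R\<close>; for the global one \<open>R\<close> and \<open>A\<close> are the least and
the greatest set of a chain.\<close>

lemma testing_estimate:
  assumes p: "1 < p" and S: "S \<subseteq> S'" "S' \<subseteq> \<Q>" and R: "R \<in> \<Q>"
    and A: "A \<in> sets \<mu>" "\<And>Q. Q \<in> S \<Longrightarrow> Q \<subseteq> A" and [measurable]: "f \<in> borel_measurable \<mu>"
    and test: "Lp_norm (conj_exponent p) \<mu> (T_adj S' (indicator R)) \<le> B"
  shows "(\<integral>\<^sup>+ x\<in>R. T S f x \<partial>\<nu>) \<le> epowr (\<integral>\<^sup>+ x\<in>A. epowr (f x) p \<partial>\<mu>) (1 / p) * B"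
proof -
  let ?f = "\<lambda>x. f x * indicator A x"
  have [measurable]: "?f \<in> borel_measurable \<mu>" using A by measurable
  have loc: "T S f x = T S ?f x" for x
  proof -
    have "(\<integral>\<^sup>+ y\<in>Q. f y \<partial>\<mu>) = (\<integral>\<^sup>+ y\<in>Q. ?f y \<partial>\<mu>)" if "Q \<in> S" for Q
      using A(2)[OF that] by (intro nn_integral_cong) (auto simp: indicator_def)
    then show ?thesis unfolding positive_op_def by (intro infsum_cong) simp
  qed
  have "(\<integral>\<^sup>+ x\<in>R. T S f x \<partial>\<nu>) = (\<integral>\<^sup>+ x. indicator R x * T S ?f x \<partial>\<nu>)"
    by (simp add: loc mult.commute)
  also have "\<dots> = (\<integral>\<^sup>+ x. ?f x * T_adj S (indicator R) x \<partial>\<mu>)"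
    using R S by (intro adjoint[symmetric]) auto
  also have "\<dots> \<le> (\<integral>\<^sup>+ x. ?f x * T_adj S' (indicator R) x \<partial>\<mu>)"
    by (intro nn_integral_mono mult_left_mono positive_op_mono_family S) simp
  also have "\<dots> \<le> Lp_norm p \<mu> ?f * Lp_norm (conj_exponent p) \<mu> (T_adj S' (indicator R))"
    using S by (intro Holder_nn_integral p) auto
  also have "\<dots> \<le> Lp_norm p \<mu> ?f * B"
    by (intro mult_left_mono test) simp
  also have "Lp_norm p \<mu> ?f = epowr (\<integral>\<^sup>+ x\<in>A. epowr (f x) p \<partial>\<mu>) (1 / p)"
    unfolding Lp_norm_def
    by (intro arg_cong[where f = "\<lambda>u. epowr u (1 / p)"] nn_integral_cong) (auto simp: indicator_def)
  finally show ?thesis .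
qed

section \<open>The local testing condition suffices\<close>

context
  fixes F :: "'a set set" and f :: "'a \<Rightarrow> ennreal"
  assumes F: "finite F" "F \<subseteq> \<Q>"
begin

text \<open>The value on \<open>Q\<close> of the part of \<open>T F f\<close> coming from sets that contain \<open>Q\<close>. If \<open>Q\<close> is the least set
of \<open>F\<close> containing \<open>x\<close>, this is \<open>T F f x\<close> itself.\<close>

definition outer_sum :: "'a set \<Rightarrow> ennreal" where
  "outer_sum Q = (\<Sum>P | P \<in> F \<and> Q \<subseteq> P. c P * (\<integral>\<^sup>+ y\<in>P. f y \<partial>\<mu>))"

lemma T_eq_sum:
  assumes "G \<subseteq> F"
  shows "T G f x = (\<Sum>P | P \<in> G \<and> x \<in> P. c P * (\<integral>\<^sup>+ y\<in>P. f y \<partial>\<mu>))"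
proof -
  have "finite G" using F assms by (auto intro: finite_subset)
  then have "T G f x = (\<Sum>P\<in>G. if x \<in> P then c P * (\<integral>\<^sup>+ y\<in>P. f y \<partial>\<mu>) else 0)"
    unfolding positive_op_finite[OF \<open>finite G\<close>] by (intro sum.cong) auto
  then show ?thesis using \<open>finite G\<close> by (simp add: sum.inter_filter)
qed

lemma superlevel_set_eq:
  "{x \<in> space \<nu>. l < T F f x} = \<Union>{Q \<in> F. l < outer_sum Q}"
proof (intro set_eqI iffI)
  fix x assume "x \<in> {x \<in> space \<nu>. l < T F f x}"
  then have x: "l < T F f x" by simp
  let ?C = "{P \<in> F. x \<in> P}"
  have "?C \<noteq> {}" using x by (intro notI) (simp add: T_eq_sum)
  then obtain R where R: "R \<in> ?C" "\<And>Q. Q \<in> ?C \<Longrightarrow> R \<subseteq> Q"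
    using obtain_least[of ?C "{x}"] F by auto
  have "{P \<in> F. R \<subseteq> P} = ?C" using R by auto
  then have "outer_sum R = T F f x" by (simp add: outer_sum_def T_eq_sum)
  then show "x \<in> \<Union>{Q \<in> F. l < outer_sum Q}" using R x by auto
next
  fix x assume "x \<in> \<Union>{Q \<in> F. l < outer_sum Q}"
  then obtain Q where Q: "Q \<in> F" "l < outer_sum Q" "x \<in> Q" by auto
  have "outer_sum Q \<le> T F f x"
    unfolding outer_sum_def T_eq_sum[OF order_refl] using F Q by (intro sum_mono2) auto
  moreover have "x \<in> space \<nu>"
    using Q F sets.sets_into_space[OF family_sets'(2)[of Q]] by auto
  ultimately show "x \<in> {x \<in> space \<nu>. l < T F f x}" using Q by auto
qed

text \<open>If some set of \<open>F\<close> strictly contains \<open>Q\<close>, there is a least such set \<open>R\<close>, and the terms above \<open>Q\<close>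
add up to \<open>outer_sum R\<close>, which is at most \<open>l\<close> because \<open>Q\<close> is maximal.\<close>

lemma maximum_principle:
  assumes Q: "Q \<in> maximal_sets {Q \<in> F. l < outer_sum Q}" and x: "x \<in> Q"
  shows "T F f x \<le> l + T {P \<in> F. P \<subseteq> Q} f x"
proof -
  let ?a = "\<lambda>P. c P * (\<integral>\<^sup>+ y\<in>P. f y \<partial>\<mu>)"
  let ?up = "{P \<in> F. Q \<subset> P}"
  have QF: "Q \<in> F" using Q by (auto simp: maximal_sets_def)
  have "{P \<in> F. x \<in> P} = ?up \<union> {P \<in> F. P \<subseteq> Q \<and> x \<in> P}"
    using laminar[of Q] QF F x by blast
  moreover have "?up \<inter> {P \<in> F. P \<subseteq> Q \<and> x \<in> P} = {}" by blast
  ultimately have "T F f x = sum ?a ?up + T {P \<in> F. P \<subseteq> Q} f x"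
    using F by (simp add: T_eq_sum sum.union_disjoint)
  moreover have "sum ?a ?up \<le> l"
  proof (cases "?up = {}")
    case False
    then obtain R where R: "R \<in> ?up" "\<And>P. P \<in> ?up \<Longrightarrow> R \<subseteq> P"
      using obtain_least[of ?up Q] F x by auto
    have "?up = {P \<in> F. R \<subseteq> P}" using R by blast
    then have "sum ?a ?up = outer_sum R" by (simp add: outer_sum_def)
    moreover have "\<not> l < outer_sum R"
      using Q R unfolding maximal_sets_def by blast
    ultimately show ?thesis by (simp add: not_less)
  next
    case True
    then show ?thesis by (simp only: sum.empty zero_le)
  qed
  ultimately show ?thesis by (simp add: add_right_mono)
qed

end

end

text \<open>The numerical dichotomy behind the good-\<open>\<lambda>\<close> inequality, with \<open>w = \<nu>(Q)\<close> and
\<open>e = \<nu>(Q \<inter> {T f > 2l})\<close>: if \<open>e\<close> exceeds the fraction \<open>\<eta> w\<close>, the hypothesis can be solved for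
\<open>w\<close>, and \<open>e \<le> w\<close>.\<close>

lemma le_of_mult_le_powr:
  fixes e w h \<eta> l q :: real
  assumes q: "1 < q" and e: "0 \<le> e" "e \<le> w" and pos: "0 < \<eta>" "0 < l" "0 \<le> h"
    and le: "l * e \<le> h * w powr (1 - 1 / q)"
  shows "e \<le> \<eta> * w + (h / (l * \<eta>)) powr q"
proof (cases "e \<le> \<eta> * w")
  case False
  then have "0 < e" using e pos by (smt (verit) mult_nonneg_nonneg)
  then have w: "0 < w" using e by simp
  have "l * (\<eta> * w) \<le> h * w powr (1 - 1 / q)"
    using le False pos by (smt (verit) mult_left_mono)
  then have "l * \<eta> * (w powr (1 / q) * w powr (1 - 1 / q)) \<le> h * w powr (1 - 1 / q)"
    using w by (simp add: powr_add[symmetric] mult.assoc)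
  then have "l * \<eta> * w powr (1 / q) \<le> h"
    using w by (simp add: mult.assoc[symmetric])
  then have "w powr (1 / q) \<le> h / (l * \<eta>)"
    using pos by (simp add: field_simps)
  then have "(w powr (1 / q)) powr q \<le> (h / (l * \<eta>)) powr q"
    using q by (intro powr_mono2) auto
  then have "e \<le> (h / (l * \<eta>)) powr q" using q w e by (simp add: powr_powr)
  moreover have "0 \<le> \<eta> * w" using pos w by simp
  ultimately show ?thesis by simp
next
  case True
  then show ?thesis by (smt (verit) powr_ge_zero)
qed

definition local_const :: "real \<Rightarrow> real" where
  "local_const q = 2 powr (q + 3)"

context laminar_pair
begin

definition local_testing :: "real \<Rightarrow> real \<Rightarrow> real \<Rightarrow> bool" where
  "local_testing p q G \<longleftrightarrow> (\<forall>R\<in>\<Q>. Lp_norm (conj_exponent p) \<mu> (T_adj {Q \<in> \<Q>. Q \<subseteq> R} (indicator R))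
     \<le> ennreal G * epowr (emeasure \<nu> R) (1 / conj_exponent q))"

text \<open>On \<open>Q \<inter> {T f > 2l}\<close> the part of \<open>T\<close> inside \<open>Q\<close> exceeds \<open>l\<close>, and its integral over \<open>Q\<close> is bounded
by testing. The exponent \<open>q/p \<ge> 1\<close> of \<open>\<integral>\<^bsub>Q\<^esub> f\<^sup>p d\<mu>\<close> is lowered to 1, at the cost of a power of
\<open>A\<close>, so that the bound is additive in \<open>Q\<close>.\<close>

lemma good_lambda_cube:
  assumes p: "1 < p" "p \<le> q" and G: "0 < G" and A: "0 < A" and l: "0 < l" and \<eta>: "0 < \<eta>"
    and test: "local_testing p q G"
    and F: "finite F" "F \<subseteq> \<Q>" and f [measurable]: "f \<in> borel_measurable \<mu>"
    and norm: "Lp_norm p \<mu> f \<le> ennreal A"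
    and Q: "Q \<in> maximal_sets {Q \<in> F. ennreal l < outer_sum F f Q}"
  shows "emeasure \<nu> (Q \<inter> {x \<in> space \<nu>. ennreal (2 * l) < T F f x})
    \<le> ennreal \<eta> * emeasure \<nu> Q
      + ennreal (A powr (q - p) * (G / (l * \<eta>)) powr q) * (\<integral>\<^sup>+ x\<in>Q. epowr (f x) p \<partial>\<mu>)"
proof -
  let ?E = "Q \<inter> {x \<in> space \<nu>. ennreal (2 * l) < T F f x}" and ?TQ = "T {P \<in> F. P \<subseteq> Q} f"
  have q: "1 < q" using p by simp
  have QQ: "Q \<in> F" "Q \<in> \<Q>" using Q F by (auto simp: maximal_sets_def)
  have [measurable]: "T F f \<in> borel_measurable \<nu>" "?TQ \<in> borel_measurable \<nu>"
    using F by (auto intro!: measurable_T)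
  have [measurable]: "?E \<in> sets \<nu>" using QQ by measurable
  obtain w where w: "emeasure \<nu> Q = ennreal w" "0 \<le> w"
    using finite_measure[OF QQ(2)] by (cases "emeasure \<nu> Q") auto
  have EQ: "emeasure \<nu> ?E \<le> emeasure \<nu> Q" using QQ by (intro emeasure_mono) auto
  then obtain e where e: "emeasure \<nu> ?E = ennreal e" "0 \<le> e" "e \<le> w"
    using w by (cases "emeasure \<nu> ?E") (auto simp: top_unique)
  have "(\<integral>\<^sup>+ x\<in>Q. epowr (f x) p \<partial>\<mu>) \<le> (\<integral>\<^sup>+ x. epowr (f x) p \<partial>\<mu>)"
    by (intro nn_integral_mono) (auto simp: indicator_def)
  also have "\<dots> \<le> ennreal (A powr p)"
    using norm p A by (simp add: Lp_norm_le_iff)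
  finally obtain i where i: "(\<integral>\<^sup>+ x\<in>Q. epowr (f x) p \<partial>\<mu>) = ennreal i" "0 \<le> i" "i \<le> A powr p"
    by (cases "\<integral>\<^sup>+ x\<in>Q. epowr (f x) p \<partial>\<mu>") (auto simp: top_unique)
  have "ennreal l * emeasure \<nu> ?E = (\<integral>\<^sup>+ x. ennreal l * indicator ?E x \<partial>\<nu>)"
    by (simp add: nn_integral_cmult_indicator)
  also have "\<dots> \<le> (\<integral>\<^sup>+ x\<in>Q. ?TQ x \<partial>\<nu>)"
  proof (intro nn_integral_mono)
    fix x
    show "ennreal l * indicator ?E x \<le> ?TQ x * indicator Q x"
    proof (cases "x \<in> ?E")
      case True
      have "ennreal l + ennreal l = ennreal (2 * l)" using l by (simp flip: ennreal_plus)
      also have "\<dots> < T F f x" using True by simp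
      also have "\<dots> \<le> ennreal l + ?TQ x" using True by (intro maximum_principle[OF F Q]) simp
      finally have "ennreal l < ?TQ x" by (simp only: ennreal_add_left_cancel_less)
      then show ?thesis using True by (simp add: less_imp_le)
    qed simp
  qed
  also have "\<dots> \<le> epowr (\<integral>\<^sup>+ x\<in>Q. epowr (f x) p \<partial>\<mu>) (1 / p)
      * (ennreal G * epowr (emeasure \<nu> Q) (1 / conj_exponent q))"
    using QQ F p test unfolding local_testing_def
    by (intro testing_estimate[where S' = "{P \<in> \<Q>. P \<subseteq> Q}"]) auto
  also have "\<dots> = ennreal (i powr (1 / p) * G * w powr (1 - 1 / q))"
    using i w G q by (simp add: inverse_conj_exponent ennreal_mult mult.assoc)
  finally have "l * e \<le> i powr (1 / p) * G * w powr (1 - 1 / q)"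
    using e l G by (simp flip: ennreal_mult)
  then have "e \<le> \<eta> * w + (i powr (1 / p) * G / (l * \<eta>)) powr q"
    using q e \<eta> l G by (intro le_of_mult_le_powr) auto
  also have "(i powr (1 / p) * G / (l * \<eta>)) powr q \<le> A powr (q - p) * (G / (l * \<eta>)) powr q * i"
  proof -
    have "i powr (q / p) \<le> i * A powr (q - p)"
    proof (cases "i = 0")
      case False
      have "i powr (q / p) = i * i powr (q / p - 1)"
        using False i by (simp add: powr_diff)
      also have "\<dots> \<le> i * (A powr p) powr (q / p - 1)"
        using i p by (intro mult_left_mono powr_mono2) auto
      also have "(A powr p) powr (q / p - 1) = A powr (q - p)"
        using p unfolding powr_powr by (intro arg_cong[where f = "\<lambda>u. A powr u"]) (simp add: right_diff_distrib)
      finally show ?thesis .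
    qed simp
    then have "i powr (q / p) * (G / (l * \<eta>)) powr q \<le> i * A powr (q - p) * (G / (l * \<eta>)) powr q"
      by (rule mult_right_mono) simp
    moreover have "(i powr (1 / p) * G / (l * \<eta>)) powr q = i powr (q / p) * (G / (l * \<eta>)) powr q"
      using powr_mult[of "i powr (1 / p)" "G / (l * \<eta>)" q] i G l \<eta> p by (simp add: powr_powr)
    ultimately show ?thesis by (simp add: mult_ac)
  qed
  finally have "ennreal e \<le> ennreal (\<eta> * w + A powr (q - p) * (G / (l * \<eta>)) powr q * i)"
    by (intro ennreal_leI) simp
  then show ?thesis
    using e w i \<eta> by (simp add: ennreal_mult)
qed

lemma good_lambda:
  assumes p: "1 < p" "p \<le> q" and G: "0 < G" and A: "0 < A" and l: "0 < l" and \<eta>: "0 < \<eta>"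
    and test: "local_testing p q G"
    and F: "finite F" "F \<subseteq> \<Q>" and f [measurable]: "f \<in> borel_measurable \<mu>"
    and norm: "Lp_norm p \<mu> f \<le> ennreal A"
  shows "emeasure \<nu> {x \<in> space \<nu>. ennreal (2 * l) < T F f x}
    \<le> ennreal \<eta> * emeasure \<nu> {x \<in> space \<nu>. ennreal l < T F f x}
      + ennreal ((A * G / (l * \<eta>)) powr q)"
proof -
  let ?E = "\<lambda>l. {x \<in> space \<nu>. ennreal l < T F f x}"
  let ?B = "{Q \<in> F. ennreal l < outer_sum F f Q}"
  let ?D = "maximal_sets ?B" and ?b = "A powr (q - p) * (G / (l * \<eta>)) powr q"
  have B: "finite ?B" "?B \<subseteq> \<Q>" using F by auto
  have D: "finite ?D" "?D \<subseteq> \<Q>" using B finite_maximal_sets maximal_sets_subset by blast+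
  have [measurable]: "T F f \<in> borel_measurable \<nu>" using F by (intro measurable_T)
  have Em: "?E l \<in> sets \<nu>" for l by measurable
  have El: "?E l = \<Union>?D"
    unfolding Union_maximal_sets[OF B(1)] by (rule superlevel_set_eq[OF F])
  have "?E (2 * l) \<subseteq> ?E l"
    using l by (auto intro: le_less_trans[rotated] ennreal_leI)
  then have "?E (2 * l) = (\<Union>Q\<in>?D. Q \<inter> ?E (2 * l))" unfolding El by auto
  then have "emeasure \<nu> (?E (2 * l)) = emeasure \<nu> (\<Union>Q\<in>?D. Q \<inter> ?E (2 * l))"
    by (rule arg_cong)
  also have "\<dots> \<le> (\<Sum>Q\<in>?D. emeasure \<nu> (Q \<inter> ?E (2 * l)))"
    using D Em by (intro emeasure_subadditive_finite) auto
  also have "\<dots> \<le> (\<Sum>Q\<in>?D. ennreal \<eta> * emeasure \<nu> Q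
      + ennreal ?b * (\<integral>\<^sup>+ x\<in>Q. epowr (f x) p \<partial>\<mu>))"
    by (intro sum_mono good_lambda_cube assms)
  also have "\<dots> = ennreal \<eta> * (\<Sum>Q\<in>?D. emeasure \<nu> Q)
      + ennreal ?b * (\<Sum>Q\<in>?D. \<integral>\<^sup>+ x\<in>Q. epowr (f x) p \<partial>\<mu>)"
    by (simp add: sum.distrib sum_distrib_left)
  also have "\<dots> \<le> ennreal \<eta> * emeasure \<nu> (?E l) + ennreal ?b * ennreal (A powr p)"
  proof (intro add_mono mult_left_mono)
    show "(\<Sum>Q\<in>?D. emeasure \<nu> Q) \<le> emeasure \<nu> (?E l)"
      using sum_over_maximal_sets[OF B sets_eq] superlevel_set_eq[OF F, of "ennreal l" f] by simp
    have "(\<Sum>Q\<in>?D. \<integral>\<^sup>+ x\<in>Q. epowr (f x) p \<partial>\<mu>) \<le> (\<integral>\<^sup>+ x. epowr (f x) p \<partial>\<mu>)"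
      by (intro sum_nn_integral_maximal_sets_le B) measurable
    also have "\<dots> \<le> ennreal (A powr p)"
      using norm p A by (simp add: Lp_norm_le_iff)
    finally show "(\<Sum>Q\<in>?D. \<integral>\<^sup>+ x\<in>Q. epowr (f x) p \<partial>\<mu>) \<le> ennreal (A powr p)" .
  qed auto
  also have "ennreal ?b * ennreal (A powr p) = ennreal ((A * G / (l * \<eta>)) powr q)"
  proof -
    have "(A * G / (l * \<eta>)) powr q = A powr q * (G / (l * \<eta>)) powr q"
      using powr_mult[of A "G / (l * \<eta>)" q] A G l \<eta> by simp
    also have "A powr q = A powr (q - p) * A powr p" by (simp add: powr_add[symmetric])
    finally show ?thesis by (simp add: ennreal_mult[symmetric] mult_ac)
  qed
  finally show ?thesis .
qed

text \<open>With \<open>\<eta> = 2\<^sup>-\<^sup>q\<^sup>-\<^sup>1\<close> the function \<open>\<phi>(l) = l\<^sup>q \<nu>{T f > l}\<close> satisfies \<open>\<phi>(2l) \<le> \<phi>(l)/2 + C\<close>.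
Since \<open>F\<close> is finite, \<open>\<phi>(l)\<close> is at most \<open>l\<^sup>q\<close> times the finite measure of its union, and iterating
downwards from \<open>l\<close> leaves \<open>\<phi>(l) \<le> 2C\<close>.\<close>

lemma weak_bound_of_local_testing_finite:
  assumes p: "1 < p" "p \<le> q" and G: "0 < G" and A: "0 < A" and l: "0 < l"
    and test: "local_testing p q G"
    and F: "finite F" "F \<subseteq> \<Q>" and f: "f \<in> borel_measurable \<mu>"
    and norm: "Lp_norm p \<mu> f \<le> ennreal A"
  shows "emeasure \<nu> {x \<in> space \<nu>. ennreal l < T F f x} \<le> ennreal ((local_const q * G * A / l) powr q)"
proof -
  have q: "1 < q" using p by simp
  let ?E = "\<lambda>l. {x \<in> space \<nu>. ennreal l < T F f x}"
  define \<eta> :: real where "\<eta> = 2 powr (- q - 1)"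
  have \<eta>: "0 < \<eta>" by (simp add: \<eta>_def)
  have UF: "\<Union>F \<in> sets \<nu>" using F by (intro sets.finite_Union) auto
  have "emeasure \<nu> (\<Union>F) \<le> (\<Sum>Q\<in>F. emeasure \<nu> Q)"
    using F family_sets sets_eq emeasure_subadditive_finite[of F "\<lambda>Q. Q" \<nu>] by simp
  also have "\<dots> < top" using F finite_measure by (auto simp: less_top)
  finally obtain W where W: "emeasure \<nu> (\<Union>F) = ennreal W" "0 \<le> W"
    by (cases "emeasure \<nu> (\<Union>F)") auto
  have sub: "emeasure \<nu> (?E l) \<le> ennreal W" for l
    unfolding superlevel_set_eq[OF F] W(1)[symmetric] using UF by (intro emeasure_mono) auto
  define v where "v l = enn2real (emeasure \<nu> (?E l))" for l
  have v: "emeasure \<nu> (?E l) = ennreal (v l)" "0 \<le> v l" "v l \<le> W" for l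
    using sub[of l] W(2) by (cases "emeasure \<nu> (?E l)"; auto simp: v_def top_unique)+
  define C where "C = (2 powr (q + 2) * A * G) powr q"
  have "0 \<le> C" by (simp add: C_def)
  have step: "(2 * l) powr q * v (2 * l) \<le> l powr q * v l / 2 + C" if l: "0 < l" for l
  proof -
    have "v (2 * l) \<le> \<eta> * v l + (A * G / (l * \<eta>)) powr q"
      using good_lambda[OF p G A l \<eta> test F f norm] v \<eta> by (simp flip: ennreal_mult ennreal_plus)
    then have "(2 * l) powr q * v (2 * l)
        \<le> (2 * l) powr q * (\<eta> * v l + (A * G / (l * \<eta>)) powr q)"
      by (rule mult_left_mono) simp
    also have "\<dots> = l powr q * v l * (2 powr q * \<eta>) + (2 * l) powr q * (A * G / (l * \<eta>)) powr q"
      using l by (simp add: powr_mult algebra_simps)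
    also have "2 powr q * \<eta> = 1 / 2"
      by (simp add: \<eta>_def powr_add[symmetric] powr_minus)
    also have "(2 * l) powr q * (A * G / (l * \<eta>)) powr q = (2 * A * G / \<eta>) powr q"
      using l \<eta> A G by (simp add: powr_mult[symmetric] mult.assoc)
    also have "2 * A * G / \<eta> = 2 powr (q + 2) * A * G"
      by (simp add: \<eta>_def powr_diff powr_minus powr_add divide_simps)
    finally show ?thesis by (simp add: C_def)
  qed
  have iter: "l powr q * v l \<le> 2 * C + (1 / 2) ^ n * (l powr q * W)" if "0 < l" for n l
    using that
  proof (induction n arbitrary: l)
    case 0
    have "l powr q * v l \<le> l powr q * W" using v by (intro mult_left_mono) auto
    then show ?case using \<open>0 \<le> C\<close> by simp
  next
    case (Suc n)
    have "l powr q * v l \<le> (l / 2) powr q * v (l / 2) / 2 + C"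
      using step[of "l / 2"] Suc.prems by simp
    also have "\<dots> \<le> (2 * C + (1 / 2) ^ n * ((l / 2) powr q * W)) / 2 + C"
      using Suc.IH[of "l / 2"] Suc.prems by simp
    also have "\<dots> \<le> (2 * C + (1 / 2) ^ n * (l powr q * W)) / 2 + C"
      using Suc.prems q W
      by (intro add_right_mono divide_right_mono add_left_mono mult_left_mono mult_right_mono powr_mono2)
        auto
    finally show ?case by (simp add: field_simps)
  qed
  have "l powr q * v l \<le> 2 * C"
  proof (rule LIMSEQ_le_const)
    show "(\<lambda>n. 2 * C + (1 / 2) ^ n * (l powr q * W)) \<longlonglongrightarrow> 2 * C"
      by (rule tendsto_eq_intros LIMSEQ_power_zero | simp)+
  qed (use iter[OF l] in auto)
  also have "\<dots> \<le> 2 powr q * C"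
    using \<open>0 \<le> C\<close> q powr_mono[of 1 q 2] by (intro mult_right_mono) auto
  also have "\<dots> = (local_const q * G * A) powr q"
  proof -
    have e: "local_const q * G * A = 2 * (2 powr (q + 2) * A * G)"
      by (simp add: local_const_def powr_add)
    show ?thesis
      unfolding e C_def by (rule powr_mult[symmetric])
  qed
  finally have "v l \<le> (local_const q * G * A) powr q / l powr q"
    using l by (simp add: field_simps)
  also have "\<dots> = (local_const q * G * A / l) powr q"
    using l A G by (simp add: powr_divide local_const_def)
  finally show ?thesis by (simp add: v ennreal_leI)
qed

lemma weak_type_of_finite_bounds:
  assumes p: "0 < p" and q: "0 < q" and K: "0 < K"
    and f: "f \<in> borel_measurable \<mu>"
    and bound: "\<And>F A l. finite F \<Longrightarrow> F \<subseteq> \<Q> \<Longrightarrow> 0 < A \<Longrightarrow> 0 < l \<Longrightarrow> Lp_norm p \<mu> f \<le> ennreal A \<Longrightarrow>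
      emeasure \<nu> {x \<in> space \<nu>. ennreal l < T F f x} \<le> ennreal ((K * A / l) powr q)"
  shows "weak_Lp_norm q \<nu> (T \<Q> f) \<le> ennreal K * Lp_norm p \<mu> f"
proof (cases "Lp_norm p \<mu> f = top")
  case True
  then show ?thesis using K by (simp add: ennreal_mult_top)
next
  case False
  have "weak_Lp_norm q \<nu> (T \<Q> f) \<le> Lp_norm p \<mu> f * ennreal K"
  proof (rule ennreal_le_mult_approx)
    fix A :: real assume A: "0 < A" "Lp_norm p \<mu> f \<le> ennreal A"
    have "weak_Lp_norm q \<nu> (T \<Q> f) \<le> ennreal (K * A)"
    proof (rule weak_Lp_normI)
      fix l :: real assume l: "0 < l"
      show "emeasure \<nu> {x \<in> space \<nu>. ennreal l < T \<Q> f x} \<le> ennreal ((K * A / l) powr q)"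
        by (rule emeasure_positive_op_le_of_finite[OF countable_family])
          (use family_sets sets_eq bound A l in auto)
    qed (use q A K in auto)
    then show "weak_Lp_norm q \<nu> (T \<Q> f) \<le> ennreal A * ennreal K"
      using A K by (simp add: ennreal_mult mult.commute)
  qed (use False in \<open>simp_all add: top.not_eq_extremum\<close>)
  then show ?thesis by (simp add: mult.commute)
qed

proposition weak_type_of_local_testing:
  assumes p: "1 < p" "p \<le> q" and G: "0 < G" and test: "local_testing p q G"
    and f: "f \<in> borel_measurable \<mu>"
  shows "weak_Lp_norm q \<nu> (T \<Q> f) \<le> ennreal (local_const q * G) * Lp_norm p \<mu> f"
  using p G weak_bound_of_local_testing_finite[OF p G _ _ test _ _ f]
  by (intro weak_type_of_finite_bounds f) (auto simp: local_const_def)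

end

section \<open>The global testing condition suffices\<close>

lemma obtain_dyadic_layer:
  fixes m w :: real
  assumes "0 < w" "w < m"
  obtains k :: nat where "w \<le> m / 2 ^ k" "m / 2 ^ Suc k \<le> w"
proof -
  obtain n where "m / w < 2 ^ n" using real_arch_pow[of 2 "m / w"] by auto
  then have n: "m / 2 ^ n \<le> w" using assms by (simp add: field_simps)
  define j where "j = (LEAST j. m / 2 ^ j \<le> w)"
  have j: "m / 2 ^ j \<le> w" unfolding j_def by (rule LeastI) (rule n)
  obtain k where k: "j = Suc k" using j assms by (cases j) auto
  have "\<not> m / 2 ^ k \<le> w" using not_less_Least[of k "\<lambda>j. m / 2 ^ j \<le> w"] k j_def by simp
  then show thesis using j k by (intro that[of k]) auto
qed

text \<open>The contributions of the dyadic layers of small sets decay with this ratio, which is below 1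
exactly because \<open>p < q\<close>.\<close>

definition layer_ratio :: "real \<Rightarrow> real \<Rightarrow> real" where
  "layer_ratio p q = 2 powr (1 / q - 1 / p)"

text \<open>Twice the sum of the geometric series over the layers. The factor \<open>2\<^sup>1\<^sup>/\<^sup>q\<close> comes from the ratio 2
between the two ends of a layer.\<close>

definition layer_const :: "real \<Rightarrow> real \<Rightarrow> real" where
  "layer_const p q = 2 * 2 powr (1 / q) / (1 - layer_ratio p q)"

definition global_const :: "real \<Rightarrow> real \<Rightarrow> real" where
  "global_const p q = layer_const p q + 2"

lemma layer_ratio:
  assumes "1 < p" "p < q"
  shows "0 < layer_ratio p q" "layer_ratio p q < 1"
proof -
  have "1 / q < 1 / p" using assms by (simp add: frac_less2)
  then show "0 < layer_ratio p q" "layer_ratio p q < 1"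
    using powr_less_mono[of "1 / q - 1 / p" 0 2] by (simp_all add: layer_ratio_def)
qed

lemma layer_const_pos: "1 < p \<Longrightarrow> p < q \<Longrightarrow> 0 < layer_const p q"
  using layer_ratio[of p q] by (simp add: layer_const_def)

context laminar_pair
begin

definition global_testing :: "real \<Rightarrow> real \<Rightarrow> real \<Rightarrow> bool" where
  "global_testing p q G \<longleftrightarrow> (\<forall>R\<in>\<Q>. Lp_norm (conj_exponent p) \<mu> (T_adj {Q \<in> \<Q>. R \<subseteq> Q} (indicator R))
     \<le> ennreal G * epowr (emeasure \<nu> R) (1 / conj_exponent q))"

text \<open>On the least set \<open>R\<close> of the chain \<open>S\<close> the function \<open>T S f\<close> is constant, equal to the sum to be
estimated. Integrating it over \<open>R\<close> and applying the testing condition there bounds \<open>\<nu>(R)\<close> times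
the sum by a multiple of \<open>\<nu>(R)\<^sup>1\<^sup>-\<^sup>1\<^sup>/\<^sup>q\<close>.\<close>

lemma chain_sum_le:
  assumes p: "1 < p" and q: "1 < q" and G: "0 < G" and test: "global_testing p q G"
    and S: "finite S" "S \<subseteq> \<Q>" "\<And>Q. Q \<in> S \<Longrightarrow> x \<in> Q"
    and f: "f \<in> borel_measurable \<mu>"
    and a: "0 < a" "\<And>Q. Q \<in> S \<Longrightarrow> ennreal a \<le> emeasure \<nu> Q"
    and i: "0 \<le> i" "\<And>Q. Q \<in> S \<Longrightarrow> (\<integral>\<^sup>+ x\<in>Q. epowr (f x) p \<partial>\<mu>) \<le> ennreal i"
  shows "(\<Sum>Q\<in>S. c Q * (\<integral>\<^sup>+ y\<in>Q. f y \<partial>\<mu>)) \<le> ennreal (G * i powr (1 / p) * a powr - (1 / q))"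
    (is "?sum \<le> _")
proof (cases "S = {}")
  case False
  obtain R where R: "R \<in> S" "\<And>Q. Q \<in> S \<Longrightarrow> R \<subseteq> Q"
    using obtain_least[OF S(1,2) False, of "{x}"] S(3) by auto
  obtain P where P: "P \<in> S" "\<And>Q. Q \<in> S \<Longrightarrow> Q \<subseteq> P"
    using obtain_greatest[OF S(1,2) False S(3)] by auto
  have RQ: "R \<in> \<Q>" "P \<in> \<Q>" using R P S by auto
  obtain w where w: "emeasure \<nu> R = ennreal w" "0 \<le> w"
    using finite_measure[OF RQ(1)] by (cases "emeasure \<nu> R") auto
  have aw: "a \<le> w" "0 < w" using a(1) a(2)[OF R(1)] w by auto
  have const: "T S f y = ?sum" if "y \<in> R" for y
    unfolding positive_op_finite[OF S(1)] using R(2)[THEN subsetD, OF _ that] by (intro sum.cong) auto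
  have "?sum * ennreal w = (\<integral>\<^sup>+ y\<in>R. ?sum \<partial>\<nu>)"
    using RQ w by (simp add: nn_integral_cmult_indicator)
  also have "\<dots> = (\<integral>\<^sup>+ y\<in>R. T S f y \<partial>\<nu>)"
  proof (intro nn_integral_cong)
    fix y
    show "?sum * indicator R y = T S f y * indicator R y"
      by (cases "y \<in> R") (simp_all add: const)
  qed
  also have "\<dots> \<le> epowr (\<integral>\<^sup>+ x\<in>P. epowr (f x) p \<partial>\<mu>) (1 / p)
      * (ennreal G * epowr (emeasure \<nu> R) (1 / conj_exponent q))"
  proof (rule testing_estimate[OF p _ _ RQ(1) _ P(2) f])
    show "S \<subseteq> {Q \<in> \<Q>. R \<subseteq> Q}" using R(2) S(2) by blast
    show "Lp_norm (conj_exponent p) \<mu> (T_adj {Q \<in> \<Q>. R \<subseteq> Q} (indicator R))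
        \<le> ennreal G * epowr (emeasure \<nu> R) (1 / conj_exponent q)"
      using test RQ(1) by (simp add: global_testing_def)
  qed (use RQ(2) in auto)
  also have "\<dots> \<le> epowr (ennreal i) (1 / p) * (ennreal G * epowr (emeasure \<nu> R) (1 / conj_exponent q))"
    using p i P by (intro mult_right_mono epowr_mono) auto
  also have "\<dots> = ennreal (G * i powr (1 / p) * w powr (- (1 / q)) * w)"
  proof -
    have "w powr (1 - 1 / q) = w powr (- (1 / q)) * w"
      using powr_add[of w "- (1 / q)" 1] aw by simp
    then show ?thesis
      using i w G q by (simp add: inverse_conj_exponent ennreal_mult[symmetric] mult_ac)
  qed
  finally have "?sum * ennreal w * ennreal (1 / w)
      \<le> ennreal (G * i powr (1 / p) * w powr (- (1 / q)) * w) * ennreal (1 / w)"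
    by (rule mult_right_mono) simp
  then have "?sum \<le> ennreal (G * i powr (1 / p) * w powr (- (1 / q)))"
    using aw G by (simp add: mult.assoc ennreal_mult[symmetric])
  also have "\<dots> \<le> ennreal (G * i powr (1 / p) * a powr - (1 / q))"
    using aw a q G by (intro ennreal_leI mult_left_mono powr_mono2') auto
  finally show ?thesis .
qed simp

text \<open>The threshold \<open>m\<close> is chosen so that the sets of measure at least \<open>m\<close> contribute at most \<open>l/2\<close>,
and then \<open>t\<close> so that the geometric series over the layers of smaller sets sums to \<open>l/2\<close>.\<close>

lemma pointwise_bound:
  assumes p: "1 < p" "p < q" and G: "0 < G" and A: "0 < A" and l: "0 < l"
    and test: "global_testing p q G"
    and F: "finite F" "F \<subseteq> \<Q>" and f: "f \<in> borel_measurable \<mu>"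
    and norm: "Lp_norm p \<mu> f \<le> ennreal A"
  defines "m \<equiv> (2 * G * A / l) powr q"
  defines "t \<equiv> (l / (layer_const p q * G)) powr p * m powr (p / q - 1)"
  assumes x: "\<And>Q. Q \<in> F \<Longrightarrow> x \<in> Q \<Longrightarrow> 0 < emeasure \<nu> Q"
    "\<And>Q. Q \<in> F \<Longrightarrow> x \<in> Q \<Longrightarrow> (\<integral>\<^sup>+ y\<in>Q. epowr (f y) p \<partial>\<mu>) \<le> ennreal t * emeasure \<nu> Q"
  shows "T F f x \<le> ennreal l"
proof -
  have q: "1 < q" using p by simp
  let ?D = "layer_const p q" and ?r = "layer_ratio p q"
  have D: "0 < ?D" using p by (rule layer_const_pos)
  have r: "0 < ?r" "?r < 1" using p by (rule layer_ratio)+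
  have m: "0 < m" using G A l by (simp add: m_def)
  have t: "0 < t" using D G l m by (simp add: t_def)
  define w where "w Q = enn2real (emeasure \<nu> Q)" for Q
  have w: "emeasure \<nu> Q = ennreal (w Q)" if "Q \<in> F" for Q
    using finite_measure[of Q] F that by (auto simp: w_def)
  let ?a = "\<lambda>Q. c Q * (\<integral>\<^sup>+ y\<in>Q. f y \<partial>\<mu>)"
  define C where "C = {Q \<in> F. x \<in> Q}"
  define C0 where "C0 = {Q \<in> C. m \<le> w Q}"
  define C1 where "C1 = {Q \<in> C. w Q < m}"
  have C: "finite C" "C = C0 \<union> C1" "C0 \<inter> C1 = {}"
    using F by (auto simp: C_def C0_def C1_def)
  have fin: "finite C0" "finite C1" using C by auto
  have wpos: "0 < w Q" if "Q \<in> C" for Q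
    using x(1)[of Q] w[of Q] that by (auto simp: C_def)
  have large: "sum ?a C0 \<le> ennreal (l / 2)"
  proof -
    have "(\<integral>\<^sup>+ y\<in>Q. epowr (f y) p \<partial>\<mu>) \<le> ennreal (A powr p)" for Q
    proof -
      have "(\<integral>\<^sup>+ y\<in>Q. epowr (f y) p \<partial>\<mu>) \<le> (\<integral>\<^sup>+ y. epowr (f y) p \<partial>\<mu>)"
        by (intro nn_integral_mono) (auto simp: indicator_def)
      also have "\<dots> \<le> ennreal (A powr p)"
        using norm p A by (simp add: Lp_norm_le_iff)
      finally show ?thesis .
    qed
    then have "sum ?a C0 \<le> ennreal (G * (A powr p) powr (1 / p) * m powr - (1 / q))"
      using p q G test F f fin m w
      by (intro chain_sum_le[where x = x]) (auto simp: C0_def C_def intro!: ennreal_leI)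
    also have "G * (A powr p) powr (1 / p) * m powr - (1 / q) = l / 2"
      using p q A G l by (simp add: m_def powr_powr powr_minus field_simps)
    finally show ?thesis .
  qed
  have "\<exists>k :: nat. w Q \<le> m / 2 ^ k \<and> m / 2 ^ Suc k \<le> w Q" if "Q \<in> C1" for Q
    using obtain_dyadic_layer[of "w Q" m] wpos[of Q] that unfolding C1_def by blast
  then obtain k :: "'a set \<Rightarrow> nat" where k: "\<And>Q. Q \<in> C1 \<Longrightarrow> w Q \<le> m / 2 ^ k Q"
    "\<And>Q. Q \<in> C1 \<Longrightarrow> m / 2 ^ Suc (k Q) \<le> w Q" by metis
  have layer: "sum ?a {Q \<in> C1. k Q = j} \<le> ennreal (l / 2 * (1 - ?r) * ?r ^ j)" for j
  proof -
    have "sum ?a {Q \<in> C1. k Q = j}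
        \<le> ennreal (G * (t * (m / 2 ^ j)) powr (1 / p) * (m / 2 ^ Suc j) powr - (1 / q))"
    proof (rule chain_sum_le[where x = x])
      fix Q assume Q: "Q \<in> {Q \<in> C1. k Q = j}"
      then have QF: "Q \<in> F" "x \<in> Q" by (auto simp: C1_def C_def)
      show "ennreal (m / 2 ^ Suc j) \<le> emeasure \<nu> Q"
        unfolding w[OF QF(1)] using k(2)[of Q] Q by (intro ennreal_leI) auto
      have "(\<integral>\<^sup>+ y\<in>Q. epowr (f y) p \<partial>\<mu>) \<le> ennreal t * ennreal (w Q)"
        using x(2)[OF QF] w[OF QF(1)] by simp
      also have "\<dots> = ennreal (t * w Q)" using t w_def by (simp add: ennreal_mult)
      also have "\<dots> \<le> ennreal (t * (m / 2 ^ j))"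
        using k(1)[of Q] Q t by (intro ennreal_leI mult_left_mono) auto
      finally show "(\<integral>\<^sup>+ y\<in>Q. epowr (f y) p \<partial>\<mu>) \<le> ennreal (t * (m / 2 ^ j))" .
    qed (use p q G test F f fin m t in \<open>auto simp: C1_def C_def\<close>)
    also have "G * (t * (m / 2 ^ j)) powr (1 / p) * (m / 2 ^ Suc j) powr - (1 / q)
        = l / 2 * (1 - ?r) * ?r ^ j"
    proof -
      have "t powr (1 / p) = l / (?D * G) * m powr (1 / q - 1 / p)"
      proof -
        have "t powr (1 / p) = (l / (?D * G)) powr (p * (1 / p)) * m powr ((p / q - 1) * (1 / p))"
          unfolding t_def using D G l by (simp add: powr_mult powr_powr)
        also have "p * (1 / p) = 1" using p by simp
        also have "(p / q - 1) * (1 / p) = 1 / q - 1 / p"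
          using p by (simp add: diff_divide_distrib)
        finally show ?thesis using D G l by simp
      qed
      moreover have "(t * (m / 2 ^ j)) powr (1 / p) = t powr (1 / p) * (m powr (1 / p) / (2 ^ j) powr (1 / p))"
        using t m by (simp add: powr_mult powr_divide)
      moreover have "(m / 2 ^ Suc j) powr - (1 / q) = m powr - (1 / q) * (2 ^ j) powr (1 / q) * 2 powr (1 / q)"
        using m by (simp add: powr_minus powr_divide powr_mult field_simps)
      moreover have "m powr (1 / q - 1 / p) * m powr (1 / p) * m powr - (1 / q) = 1"
        using m by (simp add: powr_add[symmetric])
      moreover have "?r ^ j = (2 ^ j) powr (1 / q) / (2 ^ j) powr (1 / p)"
        by (simp add: layer_ratio_def powr_power powr_powr powr_realpow[symmetric] powr_diff[symmetric]
          algebra_simps)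
      ultimately have "G * (t * (m / 2 ^ j)) powr (1 / p) * (m / 2 ^ Suc j) powr - (1 / q)
          = G * (l / (?D * G)) * 2 powr (1 / q) * ?r ^ j
            * (m powr (1 / q - 1 / p) * m powr (1 / p) * m powr - (1 / q))"
        by (simp add: mult_ac)
      also have "\<dots> = G * (l / (?D * G)) * 2 powr (1 / q) * ?r ^ j"
        using \<open>m powr (1 / q - 1 / p) * m powr (1 / p) * m powr - (1 / q) = 1\<close> by simp
      also have "\<dots> = l / 2 * (1 - ?r) * ?r ^ j"
        using G r by (simp add: layer_const_def field_simps)
      finally show ?thesis .
    qed
    finally show ?thesis .
  qed
  have small: "sum ?a C1 \<le> ennreal (l / 2)"
  proof -
    have "sum ?a C1 = (\<Sum>j\<in>k ` C1. sum ?a {Q \<in> C1. k Q = j})"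
      using fin(2) by (rule sum.image_gen)
    also have "\<dots> \<le> (\<Sum>j\<in>k ` C1. ennreal (l / 2 * (1 - ?r) * ?r ^ j))"
      by (intro sum_mono layer)
    also have "\<dots> = ennreal (\<Sum>j\<in>k ` C1. l / 2 * (1 - ?r) * ?r ^ j)"
      using l r by (intro sum_ennreal) auto
    also have "\<dots> \<le> ennreal (l / 2)"
    proof (rule ennreal_leI)
      have "(\<lambda>j. l / 2 * (1 - ?r) * ?r ^ j) sums (l / 2 * (1 - ?r) * (1 / (1 - ?r)))"
        using r by (intro sums_mult geometric_sums) auto
      moreover have "l / 2 * (1 - ?r) * (1 / (1 - ?r)) = l / 2" using r by (simp add: divide_simps)
      ultimately have s: "(\<lambda>j. l / 2 * (1 - ?r) * ?r ^ j) sums (l / 2)" by (simp only:)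
      have "(\<Sum>j\<in>k ` C1. l / 2 * (1 - ?r) * ?r ^ j) \<le> (\<Sum>j. l / 2 * (1 - ?r) * ?r ^ j)"
        using fin l r by (intro sum_le_suminf sums_summable[OF s]) auto
      then show "(\<Sum>j\<in>k ` C1. l / 2 * (1 - ?r) * ?r ^ j) \<le> l / 2"
        by (simp only: sums_unique[OF s, symmetric])
    qed
    finally show ?thesis .
  qed
  have "T F f x = sum ?a C"
    using T_eq_sum[OF F order_refl] by (simp add: C_def)
  also have "\<dots> = sum ?a C0 + sum ?a C1"
    using fin C by (simp add: sum.union_disjoint)
  also have "\<dots> \<le> ennreal (l / 2) + ennreal (l / 2)"
    by (intro add_mono large small)
  also have "\<dots> = ennreal l" using l by (simp flip: ennreal_plus)
  finally show ?thesis .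
qed

text \<open>Outside the null sets of the family, a point where \<open>T f > l\<close> lies in a set \<open>Q\<close> with
\<open>\<nu>(Q) < \<integral>\<^bsub>Q\<^esub> f\<^sup>p d\<mu> / t\<close>. The maximal sets of this kind are disjoint, so the measure of their union
is at most \<open>A\<^sup>p / t\<close>, which by the choice of \<open>t\<close> is a multiple of \<open>(G A / l)\<^sup>q\<close>.\<close>

lemma weak_bound_of_global_testing_finite:
  assumes p: "1 < p" "p < q" and G: "0 < G" and A: "0 < A" and l: "0 < l"
    and test: "global_testing p q G"
    and F: "finite F" "F \<subseteq> \<Q>" and f [measurable]: "f \<in> borel_measurable \<mu>"
    and norm: "Lp_norm p \<mu> f \<le> ennreal A"
  shows "emeasure \<nu> {x \<in> space \<nu>. ennreal l < T F f x} \<le> ennreal ((global_const p q * G * A / l) powr q)"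
proof -
  let ?D = "layer_const p q"
  have D: "0 < ?D" using p by (rule layer_const_pos)
  define m where "m = (2 * G * A / l) powr q"
  define t where "t = (l / (?D * G)) powr p * m powr (p / q - 1)"
  have m: "0 < m" using G A l by (simp add: m_def)
  have t: "0 < t" using D G l m by (simp add: t_def)
  let ?E = "{x \<in> space \<nu>. ennreal l < T F f x}"
  let ?Z = "{Q \<in> F. emeasure \<nu> Q = 0}"
  let ?B = "{Q \<in> F. ennreal t * emeasure \<nu> Q < (\<integral>\<^sup>+ y\<in>Q. epowr (f y) p \<partial>\<mu>)}"
  have B: "finite ?B" "?B \<subseteq> \<Q>" using F by auto
  have FB: "F \<subseteq> sets \<nu>" using F family_sets sets_eq by auto
  have "?E \<subseteq> \<Union>?Z \<union> \<Union>?B"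
  proof (rule subsetI, rule ccontr)
    fix x assume x: "x \<in> ?E" "x \<notin> \<Union>?Z \<union> \<Union>?B"
    have "T F f x \<le> ennreal l"
    proof (rule pointwise_bound[OF p G A l test F f norm])
      fix Q assume "Q \<in> F" "x \<in> Q"
      then show "0 < emeasure \<nu> Q" using x by (auto simp: zero_less_iff_neq_zero)
      show "(\<integral>\<^sup>+ y\<in>Q. epowr (f y) p \<partial>\<mu>)
          \<le> ennreal ((l / (?D * G)) powr p * ((2 * G * A / l) powr q) powr (p / q - 1)) * emeasure \<nu> Q"
        using x \<open>Q \<in> F\<close> \<open>x \<in> Q\<close> unfolding m_def[symmetric] t_def[symmetric] by (auto simp: not_less)
    qed
    then show False using x by auto
  qed
  then have "emeasure \<nu> ?E \<le> emeasure \<nu> (\<Union>?Z \<union> \<Union>?B)"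
    using F FB by (intro emeasure_mono) (auto intro!: sets.Un sets.finite_Union)
  also have "\<dots> \<le> emeasure \<nu> (\<Union>?Z) + emeasure \<nu> (\<Union>?B)"
    using F FB by (intro emeasure_subadditive sets.finite_Union) auto
  also have "emeasure \<nu> (\<Union>?Z) = 0"
  proof -
    have "emeasure \<nu> (\<Union>Q\<in>?Z. Q) \<le> (\<Sum>Q\<in>?Z. emeasure \<nu> Q)"
      using F FB by (intro emeasure_subadditive_finite) auto
    then show ?thesis by simp
  qed
  also have "emeasure \<nu> (\<Union>?B) = (\<Sum>Q\<in>maximal_sets ?B. emeasure \<nu> Q)"
    by (rule sum_over_maximal_sets[OF B sets_eq, symmetric])
  also have "0 + \<dots> \<le> (\<Sum>Q\<in>maximal_sets ?B. ennreal (1 / t) * (\<integral>\<^sup>+ y\<in>Q. epowr (f y) p \<partial>\<mu>))"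
    unfolding add_0
  proof (rule sum_mono)
    fix Q assume "Q \<in> maximal_sets ?B"
    then have "Q \<in> ?B" using maximal_sets_subset by blast
    then have "ennreal t * emeasure \<nu> Q \<le> (\<integral>\<^sup>+ y\<in>Q. epowr (f y) p \<partial>\<mu>)" by (simp add: less_imp_le)
    then have "ennreal (1 / t) * (ennreal t * emeasure \<nu> Q)
        \<le> ennreal (1 / t) * (\<integral>\<^sup>+ y\<in>Q. epowr (f y) p \<partial>\<mu>)"
      by (rule mult_left_mono) simp
    then show "emeasure \<nu> Q \<le> ennreal (1 / t) * (\<integral>\<^sup>+ y\<in>Q. epowr (f y) p \<partial>\<mu>)"
      using t by (simp add: mult.assoc[symmetric] ennreal_mult[symmetric])
  qed
  also have "\<dots> = ennreal (1 / t) * (\<Sum>Q\<in>maximal_sets ?B. \<integral>\<^sup>+ y\<in>Q. epowr (f y) p \<partial>\<mu>)"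
    by (simp add: sum_distrib_left)
  also have "\<dots> \<le> ennreal (1 / t) * ennreal (A powr p)"
  proof (rule mult_left_mono)
    have "(\<Sum>Q\<in>maximal_sets ?B. \<integral>\<^sup>+ y\<in>Q. epowr (f y) p \<partial>\<mu>) \<le> (\<integral>\<^sup>+ y. epowr (f y) p \<partial>\<mu>)"
      by (intro sum_nn_integral_maximal_sets_le B) measurable
    also have "\<dots> \<le> ennreal (A powr p)"
      using norm p A by (simp add: Lp_norm_le_iff)
    finally show "(\<Sum>Q\<in>maximal_sets ?B. \<integral>\<^sup>+ y\<in>Q. epowr (f y) p \<partial>\<mu>) \<le> ennreal (A powr p)" .
  qed simp
  also have "\<dots> = ennreal (A powr p / t)" using t by (simp add: ennreal_mult[symmetric])
  also have "\<dots> \<le> ennreal ((global_const p q * G * A / l) powr q)"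
  proof (rule ennreal_leI)
    let ?u = "G * A / l"
    have u: "0 < ?u" using G A l by simp
    have "A powr p / t = (?D * ?u) powr p * (2 * ?u) powr (q - p)"
    proof -
      have "m powr (p / q - 1) = (2 * ?u) powr (q * (p / q - 1))"
        by (simp add: m_def powr_powr mult.assoc)
      also have "q * (p / q - 1) = - (q - p)" using p by (simp add: right_diff_distrib)
      finally have "t = (l / (?D * G)) powr p / (2 * ?u) powr (q - p)"
        unfolding t_def powr_minus_divide by simp
      then have "A powr p / t = A powr p / (l / (?D * G)) powr p * (2 * ?u) powr (q - p)"
        by simp
      also have "A powr p / (l / (?D * G)) powr p = (?D * ?u) powr p"
        using D G l A by (simp add: powr_divide[symmetric] mult_ac)
      finally show ?thesis .
    qed
    also have "\<dots> \<le> (global_const p q * ?u) powr p * (global_const p q * ?u) powr (q - p)"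
      using u D p G A l by (intro mult_mono powr_mono2 mult_right_mono) (auto simp: global_const_def)
    also have "\<dots> = (global_const p q * ?u) powr q"
      by (simp add: powr_add[symmetric])
    finally show "A powr p / t \<le> (global_const p q * G * A / l) powr q"
      by (simp add: mult.assoc)
  qed
  finally show ?thesis .
qed

proposition weak_type_of_global_testing:
  assumes p: "1 < p" "p < q" and G: "0 < G" and test: "global_testing p q G"
    and f: "f \<in> borel_measurable \<mu>"
  shows "weak_Lp_norm q \<nu> (T \<Q> f) \<le> ennreal (global_const p q * G) * Lp_norm p \<mu> f"
  using p G layer_const_pos[OF p] weak_bound_of_global_testing_finite[OF p G _ _ test _ _ f]
  by (intro weak_type_of_finite_bounds f) (auto simp: global_const_def)

end

section \<open>Comparability in laminar families\<close>

context laminar_pair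
begin

definition weak_norm :: "real \<Rightarrow> real \<Rightarrow> ennreal" where
  "weak_norm p q = Inf {N. \<forall>f\<in>borel_measurable \<mu>. weak_Lp_norm q \<nu> (T \<Q> f) \<le> N * Lp_norm p \<mu> f}"

text \<open>The set \<open>S R\<close> is the subfamily attached to \<open>R\<close>: the sets inside \<open>R\<close> for the local condition, the
sets containing \<open>R\<close> for the global one.\<close>

definition testing_const :: "real \<Rightarrow> real \<Rightarrow> ('a set \<Rightarrow> 'a set set) \<Rightarrow> ennreal" where
  "testing_const p q S = (SUP R\<in>\<Q>. if emeasure \<nu> R = 0 then 0 else
     Lp_norm (conj_exponent p) \<mu> (T_adj (S R) (indicator R))
       / epowr (emeasure \<nu> R) (1 / conj_exponent q))"

lemma T_adj_indicator_null:
  assumes "R \<in> \<Q>" "emeasure \<nu> R = 0"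
  shows "T_adj S (indicator R) x = 0"
proof -
  have "(\<integral>\<^sup>+ y\<in>Q. indicator R y \<partial>\<nu>) = 0" for Q
  proof -
    have "(\<integral>\<^sup>+ y\<in>Q. indicator R y \<partial>\<nu>) \<le> (\<integral>\<^sup>+ y. indicator R y \<partial>\<nu>)"
      by (intro nn_integral_mono) (auto simp: indicator_def)
    then show ?thesis using assms by simp
  qed
  then show ?thesis by (simp add: positive_op_def)
qed

text \<open>Sets with \<open>\<nu>(R) = 0\<close> satisfy the testing inequality automatically, which justifies their exclusion
from the supremum.\<close>

lemma testing_const_le_iff:
  "testing_const p q S \<le> G \<longleftrightarrow> (\<forall>R\<in>\<Q>. Lp_norm (conj_exponent p) \<mu> (T_adj (S R) (indicator R))
     \<le> G * epowr (emeasure \<nu> R) (1 / conj_exponent q))"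
  unfolding testing_const_def SUP_le_iff
proof (intro ball_cong refl)
  fix R assume R: "R \<in> \<Q>"
  let ?X = "Lp_norm (conj_exponent p) \<mu> (T_adj (S R) (indicator R))"
  let ?e = "epowr (emeasure \<nu> R) (1 / conj_exponent q)"
  show "(if emeasure \<nu> R = 0 then 0 else ?X / ?e) \<le> G \<longleftrightarrow> ?X \<le> G * ?e"
  proof (cases "emeasure \<nu> R = 0")
    case True
    then show ?thesis using R by (simp add: T_adj_indicator_null Lp_norm_def)
  next
    case False
    then obtain w where "emeasure \<nu> R = ennreal w" "0 < w"
      using finite_measure[OF R] by (cases "emeasure \<nu> R") (auto simp: less_le)
    then obtain e where e: "?e = ennreal e" "0 < e"
      by (intro that[of "w powr (1 / conj_exponent q)"]) auto
    have "?X \<le> G * ?e" if "?X / ?e \<le> G"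
    proof -
      have "?X = ?X / ?e * ?e"
        using e by (simp add: divide_ennreal_def mult.assoc inverse_ennreal ennreal_mult[symmetric])
      also have "\<dots> \<le> G * ?e" using that by (rule mult_right_mono) simp
      finally show ?thesis .
    qed
    moreover have "?X / ?e \<le> G" if "?X \<le> G * ?e"
      using that e by (intro divide_le_posI_ennreal) (auto simp: mult.commute)
    ultimately show ?thesis using False by auto
  qed
qed

text \<open>The sufficiency of a testing condition is proved for positive real bounds \<open>G\<close> only. This is enough
because the constants are infima over such bounds, also when they vanish.\<close>

lemma comparable_testing_const:
  assumes p: "1 < p" and q: "1 < q" and K: "0 < K" and S: "\<And>R. S R \<subseteq> \<Q>"
    and sufficient: "\<And>G f. 0 < G \<Longrightarrow> testing_const p q S \<le> ennreal G \<Longrightarrow> f \<in> borel_measurable \<mu> \<Longrightarrow>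
      weak_Lp_norm q \<nu> (T \<Q> f) \<le> ennreal (K * G) * Lp_norm p \<mu> f"
  shows "comparable (K + kolmogorov_const q) (weak_norm p q) (testing_const p q S)"
proof -
  let ?W = "weak_norm p q" and ?L = "testing_const p q S" and ?k = "kolmogorov_const q"
  have k: "0 < ?k" using q by (rule kolmogorov_const_pos)
  have "?W \<le> ?L * ennreal K"
  proof (cases "?L = top")
    case True
    then show ?thesis using K by (simp add: ennreal_top_mult)
  next
    case False
    show ?thesis
    proof (rule ennreal_le_mult_approx)
      fix G :: real assume G: "0 < G" "?L \<le> ennreal G"
      have "?W \<le> ennreal (K * G)"
        unfolding weak_norm_def using sufficient[OF G] by (intro Inf_lower) simp
      then show "?W \<le> ennreal G * ennreal K"
        using G K by (simp add: ennreal_mult mult.commute)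
    qed (use False in \<open>simp_all add: top.not_eq_extremum\<close>)
  qed
  also have "\<dots> \<le> ?L * ennreal (K + ?k)"
    using k by (intro mult_left_mono ennreal_leI) auto
  finally have W: "?W \<le> ennreal (K + ?k) * ?L" by (simp add: mult.commute)
  have "ennreal (1 / ?k) * ?L \<le> ?W"
    unfolding weak_norm_def
  proof (rule Inf_greatest)
    fix N assume "N \<in> {N. \<forall>f\<in>borel_measurable \<mu>. weak_Lp_norm q \<nu> (T \<Q> f) \<le> N * Lp_norm p \<mu> f}"
    then have "?L \<le> ennreal ?k * N"
      unfolding testing_const_le_iff using testing_of_weak_type[OF p q S] by simp
    then have "ennreal (1 / ?k) * ?L \<le> ennreal (1 / ?k) * (ennreal ?k * N)"
      by (rule mult_left_mono) simp
    then show "ennreal (1 / ?k) * ?L \<le> N"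
      using k by (simp add: mult.assoc[symmetric] ennreal_mult[symmetric])
  qed
  then have "ennreal ?k * (ennreal (1 / ?k) * ?L) \<le> ennreal ?k * ?W"
    by (rule mult_left_mono) simp
  then have "?L \<le> ennreal ?k * ?W"
    using k by (simp add: mult.assoc[symmetric] ennreal_mult[symmetric])
  also have "\<dots> \<le> ennreal (K + ?k) * ?W"
    using K by (intro mult_right_mono ennreal_leI) auto
  finally show ?thesis using W by (simp add: comparable_def)
qed

proposition comparable_local:
  assumes p: "1 < p" "p \<le> q"
  shows "comparable (local_const q + kolmogorov_const q) (weak_norm p q)
    (testing_const p q (\<lambda>R. {Q \<in> \<Q>. Q \<subseteq> R}))"
proof (rule comparable_testing_const)
  fix G :: real and f :: "'a \<Rightarrow> ennreal"
  assume "0 < G" "testing_const p q (\<lambda>R. {Q \<in> \<Q>. Q \<subseteq> R}) \<le> ennreal G"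
    "f \<in> borel_measurable \<mu>"
  then show "weak_Lp_norm q \<nu> (T \<Q> f) \<le> ennreal (local_const q * G) * Lp_norm p \<mu> f"
    using weak_type_of_local_testing[OF p] by (simp add: local_testing_def testing_const_le_iff)
qed (use p in \<open>auto simp: local_const_def\<close>)

proposition comparable_global:
  assumes p: "1 < p" "p < q"
  shows "comparable (global_const p q + kolmogorov_const q) (weak_norm p q)
    (testing_const p q (\<lambda>R. {Q \<in> \<Q>. R \<subseteq> Q}))"
proof (rule comparable_testing_const)
  fix G :: real and f :: "'a \<Rightarrow> ennreal"
  assume "0 < G" "testing_const p q (\<lambda>R. {Q \<in> \<Q>. R \<subseteq> Q}) \<le> ennreal G"
    "f \<in> borel_measurable \<mu>"
  then show "weak_Lp_norm q \<nu> (T \<Q> f) \<le> ennreal (global_const p q * G) * Lp_norm p \<mu> f"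
    using weak_type_of_global_testing[OF p] by (simp add: global_testing_def testing_const_le_iff)
qed (use p layer_const_pos[OF p] in \<open>auto simp: global_const_def\<close>)

end

section \<open>Dyadic grids and weights\<close>

lemma cube_subset_cbox: "cube a l \<subseteq> cbox a (a + (\<chi> i. l))"
  by (auto simp: cube_def mem_box_cart less_imp_le)

lemma box_subset_cube: "box a (a + (\<chi> i. l)) \<subseteq> cube a l"
  by (auto simp: cube_def mem_box_cart less_imp_le)

lemma box_side_nonempty:
  assumes "0 < l"
  shows "box a (a + (\<chi> i. l)) \<noteq> ({} :: (real ^ 'd) set)"
proof -
  have "a + (\<chi> i. l / 2) \<in> box a (a + (\<chi> i. l))"
    using assms by (auto simp: mem_box_cart)
  then show ?thesis by blast
qed

lemma cube_sets_lebesgue: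
  fixes a :: "real ^ 'd"
  shows "cube a l \<in> sets lebesgue"
proof -
  have "cube a l = (\<Inter>i. {x. a $ i \<le> x $ i} \<inter> {x. x $ i < a $ i + l})"
    by (auto simp: cube_def)
  moreover have "{x :: real ^ 'd. a $ i \<le> x $ i} \<inter> {x. x $ i < a $ i + l} \<in> sets borel" for i
    by (intro sets.Int borel_closed borel_open closed_halfspace_component_ge_cart
      open_halfspace_component_lt_cart)
  ultimately have "cube a l \<in> sets borel" by auto
  then show ?thesis by simp
qed

text \<open>The cube of the smaller generation lies in some cube of the larger one, which either coincides with
the other cube or is disjoint from it.\<close>

lemma dyadic_grid_laminar:
  fixes \<Q> :: "(real ^ 'd) set set"
  assumes "dyadic_grid \<Q>" "P \<in> \<Q>" "Q \<in> \<Q>"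
  shows "P \<subseteq> Q \<or> Q \<subseteq> P \<or> P \<inter> Q = {}"
proof -
  obtain gen :: "int \<Rightarrow> (real ^ 'd) set set" where gen: "\<Q> = (\<Union>k. gen k)" "\<And>k. partition_on UNIV (gen k)"
    "\<And>k Q. Q \<in> gen k \<Longrightarrow> \<exists>a. Q = cube a (2 powi k)"
    "\<And>k Q. Q \<in> gen k \<Longrightarrow> \<exists>P\<in>gen (k + 1). Q \<subseteq> P"
    using assms(1) unfolding dyadic_grid_def by metis
  have up: "\<exists>P\<in>gen (k + int n). Q \<subseteq> P" if Q: "Q \<in> gen k" for Q k n
  proof (induction n)
    case 0
    then show ?case using Q by auto
  next
    case (Suc n)
    then obtain P where "P \<in> gen (k + int n)" "Q \<subseteq> P" by auto
    then obtain P' where "P' \<in> gen (k + int n + 1)" "Q \<subseteq> P'"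
      using gen(4) by (meson order_trans)
    then show ?case by (auto simp: ac_simps)
  qed
  have ordered: "Q \<subseteq> P \<or> P \<inter> Q = {}" if QP: "Q \<in> gen k" "P \<in> gen j" "k \<le> j" for P Q j k
  proof -
    obtain P' where P': "P' \<in> gen j" "Q \<subseteq> P'"
      using up[OF QP(1), of "nat (j - k)"] QP(3) by auto
    moreover have "P = P' \<or> P \<inter> P' = {}"
      using partition_onD2[OF gen(2)[of j]] QP(2) P'(1) unfolding disjoint_def by blast
    ultimately show ?thesis by blast
  qed
  obtain j k where "P \<in> gen j" "Q \<in> gen k" using assms gen(1) by auto
  then show ?thesis using ordered[of Q k P j] ordered[of P j Q k] by (cases "k \<le> j") auto
qed

text \<open>Each generation is a disjoint family of sets with nonempty interior.\<close>

lemma dyadic_grid_countable: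
  fixes \<Q> :: "(real ^ 'd) set set"
  assumes "dyadic_grid \<Q>"
  shows "countable \<Q>"
proof -
  obtain gen :: "int \<Rightarrow> (real ^ 'd) set set" where gen: "\<Q> = (\<Union>k. gen k)" "\<And>k. partition_on UNIV (gen k)"
    "\<And>k Q. Q \<in> gen k \<Longrightarrow> \<exists>a. Q = cube a (2 powi k)"
    using assms unfolding dyadic_grid_def by metis
  have "countable (gen k)" for k
  proof (rule countable_disjoint_nonempty_interior_subsets)
    show "pairwise disjnt (gen k)"
      using partition_onD2[OF gen(2)[of k]] by (simp add: disjoint_def pairwise_def disjnt_def)
    fix Q assume "Q \<in> gen k" "interior Q = {}"
    then obtain a where a: "Q = cube a (2 powi k)" using gen(3) by blast
    then have "box a (a + (\<chi> i. 2 powi k)) \<subseteq> interior Q"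
      using box_subset_cube by (intro interior_maximal) auto
    then show "Q = {}" using box_side_nonempty[of "2 powi k" a] \<open>interior Q = {}\<close> by simp
  qed
  then show ?thesis unfolding gen(1) by auto
qed

lemma dyadic_grid_cube:
  fixes \<Q> :: "(real ^ 'd) set set"
  assumes "dyadic_grid \<Q>" "Q \<in> \<Q>"
  obtains a l where "Q = cube a l"
proof -
  obtain gen :: "int \<Rightarrow> (real ^ 'd) set set" where gen: "\<Q> = (\<Union>k. gen k)"
    "\<And>k Q. Q \<in> gen k \<Longrightarrow> \<exists>a. Q = cube a (2 powi k)"
    using assms(1) unfolding dyadic_grid_def by metis
  then show thesis using assms(2) that by (metis UN_E)
qed

lemma sets_weighted [measurable_cong]: "sets (weighted w) = sets lebesgue"
  by (simp add: weighted_def)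

lemma nn_integral_weighted:
  assumes "weight w" "f \<in> borel_measurable lebesgue"
  shows "(\<integral>\<^sup>+ x. f x \<partial>weighted w) = (\<integral>\<^sup>+ x. ennreal (w x) * f x \<partial>lebesgue)"
  using assms unfolding weighted_def weight_def by (intro nn_integral_density) auto

lemma emeasure_weighted_compact:
  assumes w: "weight w" and C: "compact C"
  shows "emeasure (weighted w) C < top"
proof -
  have "set_integrable lebesgue C w" using w C by (auto simp: weight_def)
  then have "(\<integral>\<^sup>+ x. ennreal (norm (indicator C x *\<^sub>R w x)) \<partial>lebesgue) < \<infinity>"
    unfolding set_integrable_def integrable_iff_bounded by blast
  also have "(\<integral>\<^sup>+ x. ennreal (norm (indicator C x *\<^sub>R w x)) \<partial>lebesgue)
      = (\<integral>\<^sup>+ x. ennreal (w x) * indicator C x \<partial>lebesgue)"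
    using w by (intro nn_integral_cong) (auto simp: weight_def indicator_def)
  also have "\<dots> = emeasure (weighted w) C"
    unfolding weighted_def using w lmeasurable_compact[OF C]
    by (subst emeasure_density) (auto simp: weight_def)
  finally show ?thesis by simp
qed

lemma sigma_finite_weighted:
  assumes "weight w"
  shows "sigma_finite_measure (weighted w)"
proof
  let ?A = "range (\<lambda>n :: nat. cball (0 :: real ^ 'd) (real n))"
  have "\<Union>?A = UNIV"
    by (auto simp: real_arch_simple)
  moreover have "\<forall>a\<in>?A. emeasure (weighted w) a \<noteq> \<infinity>"
    using emeasure_weighted_compact[OF assms] by (auto simp: less_top)
  moreover have "?A \<subseteq> sets (weighted w)" by (auto simp: sets_weighted)
  moreover have "space (weighted w) = UNIV" by (simp add: weighted_def)
  ultimately show "\<exists>A. countable A \<and> A \<subseteq> sets (weighted w) \<and> \<Union>A = space (weighted w)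
      \<and> (\<forall>a\<in>A. emeasure (weighted w) a \<noteq> \<infinity>)"
    by (intro exI[of _ ?A]) auto
qed

definition dyadic_coeff :: "((real ^ 'd) set \<Rightarrow> real) \<Rightarrow> (real ^ 'd) set \<Rightarrow> ennreal" where
  "dyadic_coeff \<tau> Q = ennreal (\<tau> Q) / emeasure lebesgue Q"

lemma laminar_pair_dyadic:
  assumes "dyadic_grid \<Q>" "weight \<sigma>" "weight \<omega>"
  shows "laminar_pair (weighted \<sigma>) (weighted \<omega>) \<Q>"
proof (rule laminar_pair.intro)
  have sets: "Q \<in> sets lebesgue" if "Q \<in> \<Q>" for Q
    using dyadic_grid_cube[OF assms(1) that] cube_sets_lebesgue by metis
  then show "\<Q> \<subseteq> sets (weighted \<sigma>)" by (auto simp: sets_weighted)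
  fix Q assume "Q \<in> \<Q>"
  then obtain a l where Q: "Q = cube a l" by (rule dyadic_grid_cube[OF assms(1)])
  have "emeasure (weighted \<omega>) Q \<le> emeasure (weighted \<omega>) (cbox a (a + (\<chi> i. l)))"
    unfolding Q by (intro emeasure_mono cube_subset_cbox) (auto simp: sets_weighted)
  also have "\<dots> < top" by (intro emeasure_weighted_compact assms compact_cbox)
  finally show "emeasure (weighted \<omega>) Q < top" .
next
  show "P \<subseteq> Q \<or> Q \<subseteq> P \<or> P \<inter> Q = {}" if "P \<in> \<Q>" "Q \<in> \<Q>" for P Q
    using assms(1) that by (rule dyadic_grid_laminar)
qed (simp_all add: sets_weighted assms dyadic_grid_countable sigma_finite_weighted)

lemma dyadic_op_eq_positive_op:
  assumes "dyadic_grid \<Q>" "S \<subseteq> \<Q>" "weight w" and f: "f \<in> borel_measurable lebesgue"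
  shows "dyadic_op S \<tau> (\<lambda>x. f x * ennreal (w x)) = positive_op (dyadic_coeff \<tau>) S (weighted w) f"
proof
  fix x
  have "ennreal (\<tau> Q) * average Q (\<lambda>x. f x * ennreal (w x))
      = dyadic_coeff \<tau> Q * (\<integral>\<^sup>+ y\<in>Q. f y \<partial>weighted w)" if "Q \<in> S" for Q
  proof -
    have "Q \<in> sets lebesgue"
      using dyadic_grid_cube[OF assms(1)] cube_sets_lebesgue assms(2) that by (metis subsetD)
    then have "(\<integral>\<^sup>+ y\<in>Q. f y \<partial>weighted w) = (\<integral>\<^sup>+ y\<in>Q. f y * ennreal (w y) \<partial>lebesgue)"
      using assms(3) f by (subst nn_integral_weighted) (auto simp: mult_ac)
    then show ?thesis
      by (simp add: average_def dyadic_coeff_def divide_ennreal_def mult_ac)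
  qed
  then show "dyadic_op S \<tau> (\<lambda>x. f x * ennreal (w x)) x = positive_op (dyadic_coeff \<tau>) S (weighted w) f x"
    unfolding dyadic_op_def positive_op_def by (intro infsum_cong) simp
qed

lemma
  assumes grid: "dyadic_grid \<Q>" and \<sigma>: "weight \<sigma>" and \<omega>: "weight \<omega>"
  shows weak_type_norm_eq:
      "weak_type_norm \<Q> \<tau> \<sigma> \<omega> p q
        = laminar_pair.weak_norm (weighted \<sigma>) (weighted \<omega>) \<Q> (dyadic_coeff \<tau>) p q"
    and Loc_const_eq:
      "Loc_const \<Q> \<tau> \<sigma> \<omega> p q
        = laminar_pair.testing_const (weighted \<sigma>) (weighted \<omega>) \<Q> (dyadic_coeff \<tau>) p q
            (\<lambda>R. {Q \<in> \<Q>. Q \<subseteq> R})"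
    and Glo_const_eq:
      "Glo_const \<Q> \<tau> \<sigma> \<omega> p q
        = laminar_pair.testing_const (weighted \<sigma>) (weighted \<omega>) \<Q> (dyadic_coeff \<tau>) p q
            (\<lambda>R. {Q \<in> \<Q>. R \<subseteq> Q})"
proof -
  interpret laminar_pair "weighted \<sigma>" "weighted \<omega>" \<Q> "dyadic_coeff \<tau>"
    using assms by (rule laminar_pair_dyadic)
  have "measurable (weighted \<sigma>) borel = measurable lebesgue (borel :: ennreal measure)"
    by (intro measurable_cong_sets sets_weighted refl)
  then show "weak_type_norm \<Q> \<tau> \<sigma> \<omega> p q = weak_norm p q"
    unfolding weak_type_norm_def weak_norm_def
    by (simp add: dyadic_op_eq_positive_op[OF grid order_refl \<sigma>])
  have op: "dyadic_op S \<tau> (\<lambda>x. ennreal (\<omega> x) * indicator R x) = T_adj S (indicator R)"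
    if "S \<subseteq> \<Q>" "R \<in> \<Q>" for S R
    using dyadic_op_eq_positive_op[OF grid that(1) \<omega>, of "indicator R" \<tau>] family_sets'(1)[OF that(2)]
    by (simp add: sets_weighted mult.commute)
  show "Loc_const \<Q> \<tau> \<sigma> \<omega> p q = testing_const p q (\<lambda>R. {Q \<in> \<Q>. Q \<subseteq> R})"
    unfolding Loc_const_def testing_const_def T_in_def by (intro SUP_cong refl) (simp add: op)
  show "Glo_const \<Q> \<tau> \<sigma> \<omega> p q = testing_const p q (\<lambda>R. {Q \<in> \<Q>. R \<subseteq> Q})"
    unfolding Glo_const_def testing_const_def T_out_def by (intro SUP_cong refl) (simp add: op)
qed

theorem theorem1p8:
  fixes p q :: real
  assumes "1 < p" and "p \<le> q"
  shows "(\<exists>K>0. \<forall>(\<Q> :: (real ^ 'd) set set) \<tau> \<sigma> \<omega>.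
            dyadic_grid \<Q> \<longrightarrow> (\<forall>Q\<in>\<Q>. 0 \<le> \<tau> Q) \<longrightarrow> weight \<sigma> \<longrightarrow> weight \<omega> \<longrightarrow>
            comparable K (weak_type_norm \<Q> \<tau> \<sigma> \<omega> p q) (Loc_const \<Q> \<tau> \<sigma> \<omega> p q))
       \<and> (p < q \<longrightarrow>
          (\<exists>K>0. \<forall>(\<Q> :: (real ^ 'd) set set) \<tau> \<sigma> \<omega>.
            dyadic_grid \<Q> \<longrightarrow> (\<forall>Q\<in>\<Q>. 0 \<le> \<tau> Q) \<longrightarrow> weight \<sigma> \<longrightarrow> weight \<omega> \<longrightarrow>
            comparable K (weak_type_norm \<Q> \<tau> \<sigma> \<omega> p q) (Glo_const \<Q> \<tau> \<sigma> \<omega> p q)))"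
proof (intro conjI impI)
  have k: "0 < kolmogorov_const q" using assms by (intro kolmogorov_const_pos) simp
  show "\<exists>K>0. \<forall>(\<Q> :: (real ^ 'd) set set) \<tau> \<sigma> \<omega>.
      dyadic_grid \<Q> \<longrightarrow> (\<forall>Q\<in>\<Q>. 0 \<le> \<tau> Q) \<longrightarrow> weight \<sigma> \<longrightarrow> weight \<omega> \<longrightarrow>
      comparable K (weak_type_norm \<Q> \<tau> \<sigma> \<omega> p q) (Loc_const \<Q> \<tau> \<sigma> \<omega> p q)"
    using k assms
    by (intro exI[of _ "local_const q + kolmogorov_const q"])
      (auto simp: weak_type_norm_eq Loc_const_eq local_const_def[of q] add_pos_pos
        intro!: laminar_pair.comparable_local[unfolded local_const_def] laminar_pair_dyadic)
  assume "p < q"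
  show "\<exists>K>0. \<forall>(\<Q> :: (real ^ 'd) set set) \<tau> \<sigma> \<omega>.
      dyadic_grid \<Q> \<longrightarrow> (\<forall>Q\<in>\<Q>. 0 \<le> \<tau> Q) \<longrightarrow> weight \<sigma> \<longrightarrow> weight \<omega> \<longrightarrow>
      comparable K (weak_type_norm \<Q> \<tau> \<sigma> \<omega> p q) (Glo_const \<Q> \<tau> \<sigma> \<omega> p q)"
    using k assms \<open>p < q\<close> layer_const_pos[of p q]
    by (intro exI[of _ "global_const p q + kolmogorov_const q"])
      (auto simp: weak_type_norm_eq Glo_const_eq global_const_def[of p q] add_pos_pos
        intro!: laminar_pair.comparable_global[unfolded global_const_def] laminar_pair_dyadic)
qed

end
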